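(* Let $p=q\in(0,1)$ be a constant, let $\zeta\ge 40$ be a constant, and for each $n$ let $\lambda=\lambda_n=\frac{1}{\zeta n}$. Let $c=1-\frac12\left(\sqrt{\zeta^2+4\zeta}-\zeta\right)\in(0,1)$. Let $\mathcal{P}_\lambda$ be the planted matching model and $\mathcal{Q}=G(n,q)$. As $n\to\infty$, the log-likelihood ratio satisfies $$\log\frac{\mathrm{d}\mathcal{P}_\lambda}{\mathrm{d}\mathcal{Q}}(A)\ \overset{d}{\longrightarrow}\ \mathcal{N}\left(\pm\frac{c^2}{4}\,\frac{1-p}{p},\ \frac{c^2}{2}\,\frac{1-p}{p}\right),$$ where "$+$" holds for $A\sim\mathcal{P}_\lambda$ and "$-$" holds for $A\sim\mathcal{Q}$. Consequently, $$\inf_{\psi_n}\Big(\mathbb{P}_{A\sim\mathcal{P}_\lambda}[\psi_n(A)=0]+\mathbb{P}_{A\sim\mathcal{Q}}[\psi_n(A)=1]\Big)=1-\mathsf{TV}(\mathcal{P}_\lambda,\mathcal{Q})\ \longrightarrow\ 2\,\Phi\left(-\frac{c}{2\sqrt2}\sqrt{\frac{1-p}{p}}\right),$$ where the infimum is over all tests $\psi_n:\{0,1\}^{\binom{[n]}{2}}\to\{0,1\}$.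
   Context: A matching in a graph is a set of pairwise non-adjacent (vertex-disjoint) edges; the empty set is a matching. For a simple graph $G$ and $\lambda>0$, the monomer-dimer Gibbs measure on matchings $M$ of $G$ is $\mu_{\lambda,G}(M)=\lambda^{|M|}/Z_G(\lambda)$ with $Z_G(\lambda)=\sum_{M\subset G}\lambda^{|M|}$ (sum over all matchings $M$ in $G$, where $|M|$ is the number of edges). Write $\mu_\lambda=\mu_{\lambda,K_n}$, where $K_n$ is the complete graph on $[n]=\{1,\dots,n\}$. The planted matching model $\mathcal{P}_\lambda$ (with parameters $n,p,\lambda$) is the law of the adjacency matrix $A$ of a random graph on $[n]$ generated as follows: sample $M\sim\mu_\lambda$; conditionally on $M$, set $A_{ij}=1$ if $\{i,j\}\in M$, and let $A_{ij}\sim\mathrm{Bernoulli}(p)$ independently for $\{i,j\}\notin M$. The null model $\mathcal{Q}=G(n,q)$ is the Erdős–Rényi random graph on $[n]$, with all edges independent $\mathrm{Bernoulli}(q)$. Graphs are identified with elements of $\{0,1\}^{\binom{[n]}{2}}$. $\Phi$ denotes the standard Gaussian cumulative distribution function, $\mathcal{N}(a,b)$ the Gaussian law with mean $a$ and variance $b$, and $\mathsf{TV}$ the total variation distance (supremum over events of the difference of probabilities). *)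

theory Defs
  imports "HOL-Probability.Probability"
begin

text \<open>A simple graph enters only through its edge set, a set of two-element vertex sets.\<close>

definition matchings :: "'v set set \<Rightarrow> 'v set set set" where
  "matchings E = {M. M \<subseteq> E \<and> pairwise disjnt M}"

definition matching_partition_function :: "real \<Rightarrow> 'v set set \<Rightarrow> real" where
  "matching_partition_function lam E = (\<Sum>M\<in>matchings E. lam ^ card M)"

definition monomer_dimer :: "real \<Rightarrow> 'v set set \<Rightarrow> 'v set set pmf" where
  "monomer_dimer lam E = embed_pmf (\<lambda>M.
     if M \<in> matchings E then lam ^ card M / matching_partition_function lam E else 0)"

text \<open>\<open>embed_pmf\<close> is only meaningful for genuine probability mass functions. In the
  following lemma \<open>lam = 0\<close> is allowed, because \<open>1 / (\<zeta> * n)\<close> evaluates to \<open>0\<close> for \<open>n = 0\<close>.\<close>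

lemma pmf_monomer_dimer:
  fixes E :: "'a set set"
  assumes "finite E" "lam \<ge> 0"
  shows "pmf (monomer_dimer lam E) M =
    (if M \<in> matchings E then lam ^ card M / matching_partition_function lam E else 0)"
proof -
  let ?Z = "matching_partition_function lam E"
  let ?f = "\<lambda>M. if M \<in> matchings E then lam ^ card M / ?Z else 0"
  have fin: "finite (matchings E)"
    by (rule finite_subset[of _ "Pow E"]) (use assms in \<open>auto simp: matchings_def\<close>)
  have empty: "{} \<in> matchings E"
    by (simp add: matchings_def)
  have "lam ^ card ({} :: 'a set set) \<le> ?Z"
    unfolding matching_partition_function_def
    by (rule member_le_sum[OF empty]) (use fin assms in auto)
  then have Z: "?Z > 0"
    by simp
  have nonneg: "?f M \<ge> 0" for M
    using Z assms by simp
  have "(\<integral>\<^sup>+M. ennreal (?f M) \<partial>count_space UNIV) = (\<Sum>M\<in>matchings E. ennreal (?f M))"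
    by (rule nn_integral_count_space'[OF fin]) auto
  also have "\<dots> = ennreal (\<Sum>M\<in>matchings E. ?f M)"
    by (rule sum_ennreal) (rule nonneg)
  also have "(\<Sum>M\<in>matchings E. ?f M) = (\<Sum>M\<in>matchings E. lam ^ card M) / ?Z"
    by (simp add: sum_divide_distrib)
  also have "\<dots> = 1"
    using Z by (simp add: matching_partition_function_def)
  finally have "(\<integral>\<^sup>+M. ennreal (?f M) \<partial>count_space UNIV) = 1"
    by simp
  then show ?thesis
    unfolding monomer_dimer_def by (subst pmf_embed_pmf[OF nonneg]) auto
qed

definition complete_edges :: "nat \<Rightarrow> nat set set" where
  "complete_edges n = {e. e \<subseteq> {1..n} \<and> card e = 2}"

text \<open>A graph on \<open>{1..n}\<close> is its adjacency matrix, a function \<open>A :: nat set \<Rightarrow> bool\<close> indexed by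
  the unordered pairs \<open>{i, j} \<in> complete_edges n\<close>; off these pairs \<open>A\<close> takes the dummy
  value \<open>False\<close> (almost surely under both models below).\<close>

definition planted_model :: "nat \<Rightarrow> real \<Rightarrow> real \<Rightarrow> (nat set \<Rightarrow> bool) pmf" where
  "planted_model n p lam =
     bind_pmf (monomer_dimer lam (complete_edges n)) (\<lambda>M.
       Pi_pmf (complete_edges n) False
         (\<lambda>e. if e \<in> M then return_pmf True else bernoulli_pmf p))"

definition null_model :: "nat \<Rightarrow> real \<Rightarrow> (nat set \<Rightarrow> bool) pmf" where
  "null_model n q = Pi_pmf (complete_edges n) False (\<lambda>_. bernoulli_pmf q)"

definition log_likelihood_ratio :: "'a pmf \<Rightarrow> 'a pmf \<Rightarrow> 'a \<Rightarrow> real" where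
  "log_likelihood_ratio P Q A = ln (enn2real (RN_deriv (measure_pmf Q) (measure_pmf P) A))"

definition law_of :: "'a pmf \<Rightarrow> ('a \<Rightarrow> real) \<Rightarrow> real measure" where
  "law_of P X = distr (measure_pmf P) borel X"

text \<open>The second parameter of \<open>normal_density\<close> is the standard deviation, whereas \<open>b\<close> is
  the variance.\<close>

definition gaussian :: "real \<Rightarrow> real \<Rightarrow> real measure" where
  "gaussian a b = density lborel (\<lambda>x. ennreal (normal_density a (sqrt b) x))"

definition std_normal_cdf :: "real \<Rightarrow> real" where
  "std_normal_cdf = cdf std_normal_distribution"

definition total_variation :: "'a pmf \<Rightarrow> 'a pmf \<Rightarrow> real" where
  "total_variation P Q = (SUP S. measure_pmf.prob P S - measure_pmf.prob Q S)"

text \<open>A test is a Boolean function of the graph; \<open>True\<close> stands for \<open>1\<close> and \<open>False\<close> for \<open>0\<close>.\<close>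

definition testing_error :: "'a pmf \<Rightarrow> 'a pmf \<Rightarrow> ('a \<Rightarrow> bool) \<Rightarrow> real" where
  "testing_error P Q \<psi> =
     measure_pmf.prob P {A. \<psi> A = False} + measure_pmf.prob Q {A. \<psi> A = True}"

end

theory Submission
  imports Defs "HOL-Real_Asymp.Real_Asymp"
begin

text \<open>With \<open>y e = (1 - p) / p\<close> if \<open>e\<close> is an edge and \<open>y e = - 1\<close> otherwise, the likelihood ratio is
  \<open>L = (\<Sum>S. a S * (\<Prod>e\<in>S. y e))\<close>, where \<open>a S\<close> is the probability that the planted matching
  contains \<open>S\<close>. For a matching \<open>S\<close> with \<open>k\<close> edges, \<open>a S\<close> is close to \<open>(c / n) ^ k\<close>, and
  almost all sets of \<open>k\<close> edges are matchings; by orthogonality \<open>L\<close> is therefore close in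
  \<open>L\<^sup>2\<close> under the null model to the product \<open>G = (\<Prod>e. 1 + c / n * y e)\<close>, the dominating series
  being that of an exponential.

  The expectations of complex powers of \<open>G\<close> are explicit. They give the characteristic function
  of \<open>ln L\<close> under the null model at exponent \<open>it\<close>, and under the planted model, after a change
  of measure, at exponent \<open>1 + it\<close>. Passing from \<open>G\<close> to \<open>L\<close> is possible without controlling
  small values of \<open>L\<close>, because \<open>x \<mapsto> x * exp (i * t * ln x)\<close> is Lipschitz and
  \<open>1 / G\<close> is bounded in \<open>L\<^sup>2\<close>. The total variation distance is the null
  expectation of \<open>max 0 (1 - L)\<close>, a bounded continuous function of \<open>ln L\<close>.\<close>

section \<open>Matchings of complete graphs\<close>

text \<open>An arbitrary vertex set is allowed because deleting the vertices covered by a matching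
  leaves a complete graph on a set that need not be an initial segment.\<close>

definition pairs :: "'v set \<Rightarrow> 'v set set" where
  "pairs V = {e. e \<subseteq> V \<and> card e = 2}"

lemma complete_edges_eq_pairs: "complete_edges n = pairs {1..n}"
  by (simp add: complete_edges_def pairs_def)

lemma finite_pairs: "finite V \<Longrightarrow> finite (pairs V)"
  by (auto simp: pairs_def)

lemma card_pairs: "finite V \<Longrightarrow> card (pairs V) = card V choose 2"
  by (simp add: pairs_def n_subsets)

lemma finite_matchings: "finite E \<Longrightarrow> finite (matchings E)"
  by (rule finite_subset[of _ "Pow E"]) (auto simp: matchings_def)

lemma matchings_subset: "M \<in> matchings E \<Longrightarrow> S \<subseteq> M \<Longrightarrow> S \<in> matchings E"
  by (auto simp: matchings_def intro: pairwise_subset)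

lemma empty_in_matchings: "{} \<in> matchings E"
  by (simp add: matchings_def)

lemma card_Union_matching:
  assumes "finite V" "S \<in> matchings (pairs V)"
  shows "card (\<Union>S) = 2 * card S"
proof -
  have "card (\<Union>S) = sum card S"
    using assms
    by (intro card_Union_disjoint) (auto simp: matchings_def pairs_def intro: finite_subset)
  also have "\<dots> = sum (\<lambda>_. 2) S"
    using assms by (intro sum.cong) (auto simp: matchings_def pairs_def)
  finally show ?thesis by simp
qed

lemma matching_extension_disjoint:
  assumes "M' \<in> matchings (pairs (V - \<Union>S))"
  shows "S \<inter> M' = {}"
proof -
  have "e \<notin> M'" if "e \<in> S" for e
  proof
    assume "e \<in> M'"
    with assms have "e \<subseteq> V - \<Union>S" "card e = 2"
      by (auto simp: matchings_def pairs_def)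
    with \<open>e \<in> S\<close> have "e = {}" by auto
    with \<open>card e = 2\<close> show False by simp
  qed
  then show ?thesis by auto
qed

text \<open>The remaining edges of a matching that contains \<open>S\<close> avoid every vertex
  covered by \<open>S\<close>, so they form a matching of the complete graph on the uncovered
  vertices. Removing \<open>S\<close> is the inverse map.\<close>

lemma bij_betw_matching_extension:
  assumes S: "S \<in> matchings (pairs V)"
  shows "bij_betw (\<lambda>M'. S \<union> M') (matchings (pairs (V - \<Union>S)))
           {M \<in> matchings (pairs V). S \<subseteq> M}"
proof (rule bij_betwI[where g = "\<lambda>M. M - S"])
  show "(\<union>) S \<in> matchings (pairs (V - \<Union>S)) \<rightarrow> {M \<in> matchings (pairs V). S \<subseteq> M}"
  proof (intro Pi_I CollectI conjI)
    fix M' assume M': "M' \<in> matchings (pairs (V - \<Union>S))"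
    have cross: "disjnt a b" if "a \<in> S" "b \<in> M'" for a b
      using that M' by (fastforce simp: matchings_def pairs_def disjnt_def)
    have "pairwise disjnt (S \<union> M')"
      using S M' cross unfolding pairwise_def matchings_def
      by (auto simp: disjnt_sym)
    then show "S \<union> M' \<in> matchings (pairs V)"
      using S M' by (auto simp: matchings_def pairs_def)
  qed auto
  show "(\<lambda>M. M - S) \<in> {M \<in> matchings (pairs V). S \<subseteq> M} \<rightarrow> matchings (pairs (V - \<Union>S))"
  proof (intro Pi_I)
    fix M assume "M \<in> {M \<in> matchings (pairs V). S \<subseteq> M}"
    then have M: "M \<subseteq> pairs V" "pairwise disjnt M" "S \<subseteq> M"
      by (auto simp: matchings_def)
    have "e \<subseteq> V - \<Union>S" if e: "e \<in> M - S" for e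
    proof -
      have "disjnt e a" if "a \<in> S" for a
        using M e that by (metis DiffD1 DiffD2 pairwise_def subsetD)
      then show ?thesis using e M by (auto simp: disjnt_def pairs_def)
    qed
    then show "M - S \<in> matchings (pairs (V - \<Union>S))"
      using M by (auto simp: matchings_def pairs_def intro: pairwise_subset)
  qed
next
  fix M' assume "M' \<in> matchings (pairs (V - \<Union>S))"
  then show "S \<union> M' - S = M'"
    using matching_extension_disjoint by blast
qed auto

lemma card_matching_extension:
  assumes "finite V" "S \<in> matchings (pairs V)" "M' \<in> matchings (pairs (V - \<Union>S))"
  shows "card (S \<union> M') = card S + card M'"
proof (rule card_Un_disjoint)
  show "finite S" "finite M'"
    using assms finite_pairs[of V] finite_pairs[of "V - \<Union>S"]
    by (auto simp: matchings_def intro: finite_subset)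
  show "S \<inter> M' = {}"
    using assms(3) by (rule matching_extension_disjoint)
qed

text \<open>Sizes add along the bijection, so the weights factorise. Divided by the partition
  function, this becomes the probability that the random matching contains \<open>S\<close>.\<close>

lemma sum_matchings_superset:
  assumes "finite V" "S \<in> matchings (pairs V)"
  shows "(\<Sum>M | M \<in> matchings (pairs V) \<and> S \<subseteq> M. (lam::real) ^ card M) =
    lam ^ card S * matching_partition_function lam (pairs (V - \<Union>S))"
proof -
  have "(\<Sum>M | M \<in> matchings (pairs V) \<and> S \<subseteq> M. lam ^ card M) =
      (\<Sum>M' \<in> matchings (pairs (V - \<Union>S)). lam ^ card (S \<union> M'))"
    by (rule sum.reindex_bij_betw[OF bij_betw_matching_extension[OF assms(2)], symmetric])
  then show ?thesis
    by (simp add: card_matching_extension[OF assms] power_add matching_partition_function_def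
        sum_distrib_left)
qed

text \<open>The partition function of the complete graph on \<open>n\<close> vertices, which is a
  rescaled Hermite polynomial with all signs made positive. The last clause singles out one vertex:
  it is unmatched, or matched to one of \<open>Suc n\<close> others with \<open>n\<close> vertices
  left over.\<close>

fun complete_partition :: "real \<Rightarrow> nat \<Rightarrow> real" where
  "complete_partition lam 0 = 1"
| "complete_partition lam (Suc 0) = 1"
| "complete_partition lam (Suc (Suc n)) =
     complete_partition lam (Suc n) + lam * real (Suc n) * complete_partition lam n"

text \<open>Matchings are classified by the partner of \<open>v\<close>. The matched case is phrased
  as containing the matching \<open>{{v, u}}\<close>, so that \<open>sum_matchings_superset\<close>
  applies to it.\<close>

lemma matchings_pairs_insert:
  assumes "v \<notin> W"
  shows "matchings (pairs (insert v W)) = matchings (pairs W) \<union>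
    (\<Union>u\<in>W. {M \<in> matchings (pairs (insert v W)). {{v, u}} \<subseteq> M})"
proof -
  have "M \<in> matchings (pairs W)"
    if M: "M \<in> matchings (pairs (insert v W))" and no: "\<forall>u\<in>W. {v, u} \<notin> M" for M
  proof -
    have "e \<subseteq> W" if "e \<in> M" for e
    proof -
      have "e \<subseteq> insert v W" "card e = 2"
        using M that by (auto simp: matchings_def pairs_def)
      moreover have "v \<notin> e"
      proof
        assume "v \<in> e"
        with \<open>card e = 2\<close> obtain u where "e = {v, u}" "u \<noteq> v"
          by (auto simp: card_2_iff)
        with \<open>e \<subseteq> insert v W\<close> no that show False by auto
      qed
      ultimately show ?thesis by auto
    qed
    with M show ?thesis by (auto simp: matchings_def pairs_def)
  qed
  moreover have "matchings (pairs W) \<subseteq> matchings (pairs (insert v W))"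
    by (auto simp: matchings_def pairs_def)
  ultimately show ?thesis by blast
qed

text \<open>One vertex \<open>v\<close> is split off. The matchings that leave \<open>v\<close> bare
  give the value for \<open>Suc n\<close> vertices; each of the \<open>Suc n\<close> possible
  partners gives \<open>lam\<close> times the value for \<open>n\<close> vertices. The classes are
  disjoint, since two different edges at \<open>v\<close> intersect.\<close>

lemma matching_partition_function_pairs:
  assumes "finite V"
  shows "matching_partition_function lam (pairs V) = complete_partition lam (card V)"
  using assms
proof (induction lam "card V" arbitrary: V rule: complete_partition.induct)
  case (1 lam)
  then have "matchings (pairs V) = {{}}"
    by (auto simp: matchings_def pairs_def)
  with 1 show ?case by (simp add: matching_partition_function_def)
next
  case (2 lam)
  then obtain v where "V = {v}" by (metis One_nat_def card_1_singletonE)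
  moreover have "pairs {v} = {}"
    by (auto simp: pairs_def subset_singleton_iff)
  ultimately have "matchings (pairs V) = {{}}"
    by (auto simp: matchings_def)
  then have "matching_partition_function lam (pairs V) = 1"
    by (simp add: matching_partition_function_def)
  with \<open>Suc 0 = card V\<close>[symmetric] show ?case by simp
next
  case (3 lam n)
  then obtain v W where V: "V = insert v W" "v \<notin> W" "card W = Suc n"
    by (metis card_Suc_eq)
  then have fW: "finite W" using 3 by auto
  define T where "T u = {M \<in> matchings (pairs V). {{v, u}} \<subseteq> M}" for u
  have fin: "finite (matchings (pairs V))" "finite (matchings (pairs W))"
    using 3 fW by (simp_all add: finite_matchings finite_pairs)
  have "(\<Sum>M\<in>matchings (pairs V). lam ^ card M) =
      (\<Sum>M\<in>matchings (pairs W) \<union> (\<Union>u\<in>W. T u). lam ^ card M)"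
    unfolding T_def V(1) by (subst matchings_pairs_insert[OF V(2)]) simp
  also have "\<dots> = (\<Sum>M\<in>matchings (pairs W). lam ^ card M) + (\<Sum>M\<in>(\<Union>u\<in>W. T u). lam ^ card M)"
  proof (rule sum.union_disjoint)
    show "finite (matchings (pairs W))" "finite (\<Union> (T ` W))"
      using fin fW by (auto simp: T_def)
    show "matchings (pairs W) \<inter> \<Union> (T ` W) = {}"
      using V(2) by (auto simp: T_def matchings_def pairs_def)
  qed
  also have "(\<Sum>M\<in>(\<Union>u\<in>W. T u). lam ^ card M) = (\<Sum>u\<in>W. \<Sum>M\<in>T u. lam ^ card M)"
  proof (rule sum.UNION_disjoint)
    show "\<forall>u\<in>W. \<forall>u'\<in>W. u \<noteq> u' \<longrightarrow> T u \<inter> T u' = {}"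
    proof (intro ballI impI equals0I)
      fix u u' M assume "u \<in> W" "u' \<in> W" "u \<noteq> u'" "M \<in> T u \<inter> T u'"
      then have "{v, u} \<in> M" "{v, u'} \<in> M" "pairwise disjnt M"
        by (auto simp: T_def matchings_def)
      then have "{v, u} = {v, u'}"
        by (metis disjnt_insert1 insertI1 pairwise_def)
      then show False using \<open>u \<noteq> u'\<close> by (simp add: doubleton_eq_iff)
    qed
  qed (use fW fin in \<open>auto simp: T_def\<close>)
  also have "\<dots> = (\<Sum>u\<in>W. lam * complete_partition lam n)"
  proof (rule sum.cong)
    fix u assume u: "u \<in> W"
    then have "u \<noteq> v" using V by auto
    then have S: "{{v, u}} \<in> matchings (pairs V)"
      using u V by (auto simp: matchings_def pairs_def)
    have "V - \<Union>{{v, u}} = W - {u}" using V by auto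
    moreover have "card (W - {u}) = n" using u V fW by simp
    ultimately have c: "n = card (V - \<Union>{{v, u}})" by simp
    show "(\<Sum>M\<in>T u. lam ^ card M) = lam * complete_partition lam n"
      unfolding T_def using sum_matchings_superset[OF \<open>finite V\<close> S, of lam] "3.hyps"(2)[OF c]
        c 3(4) by simp
  qed simp
  also have "(\<Sum>M\<in>matchings (pairs W). lam ^ card M) = complete_partition lam (Suc n)"
    using 3(1)[of W] V(3) fW by (simp add: matching_partition_function_def)
  finally show ?case
    using \<open>Suc (Suc n) = card V\<close>[symmetric] V(3)
    by (simp add: matching_partition_function_def algebra_simps)
qed

text \<open>Double counting of the pairs \<open>S \<subseteq> M\<close> of matchings with
  \<open>k\<close> and \<open>Suc k\<close> edges: \<open>M\<close> has \<open>Suc k\<close> such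
  subsets, and \<open>S\<close> extends by any edge between uncovered vertices. If
  \<open>2 * k\<close> exceeds the number of vertices, there is no \<open>S\<close> and both sides
  are 0.\<close>

lemma card_matchings_Suc:
  assumes "finite V"
  shows "Suc k * card {M \<in> matchings (pairs V). card M = Suc k} =
    card {M \<in> matchings (pairs V). card M = k} * (card V - 2 * k choose 2)"
proof -
  let ?m = "\<lambda>k. {M \<in> matchings (pairs V). card M = k}"
  have fin: "finite (?m k)" for k
    using assms by (simp add: finite_matchings finite_pairs)
  have up: "card {M \<in> ?m (Suc k). S \<subseteq> M} = (card V - 2 * k choose 2)" if S: "S \<in> ?m k" for S
  proof -
    let ?W = "V - \<Union>S"
    have fS: "finite S"
      using S assms finite_pairs[of V] by (auto simp: matchings_def intro: finite_subset)
    have S': "S \<in> matchings (pairs V)" using S by simp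
    have bij: "bij_betw ((\<union>) S) {M' \<in> matchings (pairs ?W). card M' = 1}
        {M \<in> ?m (Suc k). S \<subseteq> M}"
      unfolding bij_betw_def
    proof
      have b: "inj_on ((\<union>) S) (matchings (pairs ?W))"
        "(\<union>) S ` matchings (pairs ?W) = {M \<in> matchings (pairs V). S \<subseteq> M}"
        using bij_betw_matching_extension[OF S'] by (auto simp: bij_betw_def)
      show "inj_on ((\<union>) S) {M' \<in> matchings (pairs ?W). card M' = 1}"
        using b(1) by (rule inj_on_subset) auto
      have c: "card (S \<union> M') = k + card M'" if "M' \<in> matchings (pairs ?W)" for M'
        using card_matching_extension[OF assms S' that] S by simp
      show "(\<union>) S ` {M' \<in> matchings (pairs ?W). card M' = 1} = {M \<in> ?m (Suc k). S \<subseteq> M}"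
      proof (intro equalityI subsetI)
        fix M assume "M \<in> {M \<in> ?m (Suc k). S \<subseteq> M}"
        moreover from this obtain M' where "M' \<in> matchings (pairs ?W)" "M = S \<union> M'"
          using b(2) by blast
        ultimately show "M \<in> (\<union>) S ` {M' \<in> matchings (pairs ?W). card M' = 1}"
          using c by auto
      next
        fix M assume "M \<in> (\<union>) S ` {M' \<in> matchings (pairs ?W). card M' = 1}"
        then obtain M' where "M' \<in> matchings (pairs ?W)" "M = S \<union> M'" "card M' = 1" by auto
        moreover from this have "M \<in> {M \<in> matchings (pairs V). S \<subseteq> M}" using b(2) by blast
        ultimately show "M \<in> {M \<in> ?m (Suc k). S \<subseteq> M}" using c by simp
      qed
    qed
    have "{M' \<in> matchings (pairs ?W). card M' = 1} = (\<lambda>e. {e}) ` pairs ?W"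
      by (auto simp: matchings_def card_1_singleton_iff)
    then have "card {M' \<in> matchings (pairs ?W). card M' = 1} = card (pairs ?W)"
      by (simp add: card_image)
    also have "\<dots> = card ?W choose 2" using assms by (simp add: card_pairs)
    also have "card ?W = card V - 2 * k"
      using card_Union_matching[OF assms S'] S assms
      by (subst card_Diff_subset) (auto simp: matchings_def pairs_def intro: finite_subset)
    finally show ?thesis using bij_betw_same_card[OF bij] by simp
  qed
  have down: "card {S \<in> ?m k. S \<subseteq> M} = Suc k" if M: "M \<in> ?m (Suc k)" for M
  proof -
    have "{S \<in> ?m k. S \<subseteq> M} = {S. S \<subseteq> M \<and> card S = k}"
      using M by (auto intro: matchings_subset)
    moreover have "finite M"
      using M by (auto intro: card_ge_0_finite)
    ultimately show ?thesis using M by (simp add: n_subsets)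
  qed
  have "(\<Sum>M\<in>?m (Suc k). \<Sum>S | S \<in> ?m k \<and> S \<subseteq> M. 1::nat) =
      (\<Sum>S\<in>?m k. \<Sum>M | M \<in> ?m (Suc k) \<and> S \<subseteq> M. 1)"
    by (rule sum.swap_restrict[OF fin fin])
  then have "(\<Sum>M\<in>?m (Suc k). card {S \<in> ?m k. S \<subseteq> M}) =
      (\<Sum>S\<in>?m k. card {M \<in> ?m (Suc k). S \<subseteq> M})"
    by simp
  also have "(\<Sum>S\<in>?m k. card {M \<in> ?m (Suc k). S \<subseteq> M}) = (\<Sum>S\<in>?m k. (card V - 2 * k choose 2))"
    by (rule sum.cong[OF refl up])
  also have "(\<Sum>M\<in>?m (Suc k). card {S \<in> ?m k. S \<subseteq> M}) = (\<Sum>M\<in>?m (Suc k). Suc k)"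
    by (rule sum.cong[OF refl down])
  finally show ?thesis by (simp add: mult.commute)
qed

section \<open>Asymptotics of matching counts\<close>

lemma complete_partition_pos: "lam \<ge> 0 \<Longrightarrow> complete_partition lam n > 0"
  by (induction lam n rule: complete_partition.induct) (auto intro!: add_pos_nonneg)

lemma complete_partition_mono: "lam \<ge> 0 \<Longrightarrow> mono (complete_partition lam)"
proof (rule incseq_SucI)
  fix n assume "lam \<ge> 0"
  then show "complete_partition lam n \<le> complete_partition lam (Suc n)"
    using complete_partition_pos[of lam "n - 1"] by (cases n) auto
qed

text \<open>The ratios \<open>x m\<close> of consecutive values satisfy \<open>1 / x (Suc m) = 1 + lam * m * x m\<close>,
  a contraction whose fixed point at \<open>m = N\<close> is \<open>r\<close>.\<close>

lemma complete_partition_ratio: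
  assumes "\<zeta> \<ge> 40" "0 < r" "r \<le> 1" "r\<^sup>2 / \<zeta> = 1 - r" "lam = 1 / (\<zeta> * real N)" "Suc m \<le> N"
  shows "\<bar>complete_partition lam m / complete_partition lam (Suc m) - r\<bar> \<le>
    (real N + 1 - real m) / real N"
  using assms(6)
proof (induction m)
  case 0
  have "\<bar>1 - r\<bar> \<le> 1" using assms(2,3) by simp
  also have "1 \<le> (real N + 1) / real N" using 0 by simp
  finally show ?case by simp
next
  case (Suc m)
  let ?z = "complete_partition lam"
  define x where "x = ?z m / ?z (Suc m)"
  have lam: "lam \<ge> 0" using assms by simp
  have N: "real N > 0" using Suc.prems by simp
  note pos = complete_partition_pos[OF lam]
  have x: "0 < x" "x \<le> 1"
    using pos[of m] pos[of "Suc m"] complete_partition_mono[OF lam]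
    by (auto simp: x_def mono_iff_le_Suc divide_le_eq)
  define d where "d = 1 + lam * real (Suc m) * x"
  have d: "d \<ge> 1" using lam x by (simp add: d_def)
  have y: "?z (Suc m) / ?z (Suc (Suc m)) = 1 / d"
    using pos[of m] pos[of "Suc m"] by (simp add: d_def x_def field_simps)
  \<comment> \<open>The quadratic equation for \<open>r\<close>, rewritten as the fixed point
    equation of the recursion.\<close>
  have r: "1 = r * (1 + r / \<zeta>)"
    using assms(4) by (simp add: power2_eq_square algebra_simps)
  have IH: "\<bar>x - r\<bar> \<le> (real N + 1 - real m) / real N"
    using Suc by (simp add: x_def)
  have "1 / d - r = (1 - r * d) / d" using d by (simp add: field_simps)
  also have "1 - r * d = r * (1 + r / \<zeta>) - r * d"
    using r by metis
  also have "\<dots> = r * (r / \<zeta> - lam * real (Suc m) * x)"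
    by (simp add: d_def algebra_simps)
  finally have eq: "1 / d - r = r * (r / \<zeta> - lam * real (Suc m) * x) / d" .
  have "\<bar>1 / d - r\<bar> = r * \<bar>r / \<zeta> - lam * real (Suc m) * x\<bar> / d"
    unfolding eq using d assms(2) by (simp add: abs_mult)
  also have "\<dots> \<le> 1 * \<bar>r / \<zeta> - lam * real (Suc m) * x\<bar> / 1"
    using d assms(2,3) by (intro frac_le mult_mono) auto
  \<comment> \<open>There are two sources of error: \<open>x\<close> differs from \<open>r\<close>,
    and the coefficient \<open>lam * Suc m\<close> falls short of \<open>1 / \<zeta>\<close>, its
    value at index \<open>N\<close>.\<close>
  also have "r / \<zeta> - lam * real (Suc m) * x =
      ((r - x) + x * (real N - real (Suc m)) / real N) / \<zeta>"
    unfolding assms(5) using assms(1) N by (simp add: field_simps)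
  also have "1 * \<bar>((r - x) + x * (real N - real (Suc m)) / real N) / \<zeta>\<bar> / 1 =
      \<bar>(r - x) + x * (real N - real (Suc m)) / real N\<bar> / \<zeta>"
    using assms(1) by simp
  also have "\<dots> \<le> (\<bar>x - r\<bar> + \<bar>x * (real N - real (Suc m)) / real N\<bar>) / \<zeta>"
    using assms(1) by (intro divide_right_mono, linarith, simp)
  also have "\<dots> \<le> ((real N + 1 - real m) / real N + 1 * (real N - real (Suc m)) / real N) / \<zeta>"
    using IH x N Suc.prems assms(1)
    by (intro divide_right_mono add_mono) (auto simp: abs_mult intro!: divide_right_mono mult_right_mono)
  also have "\<dots> = (2 * real N - 2 * real m) / real N / \<zeta>"
    unfolding add_divide_distrib[symmetric] by simp
  \<comment> \<open>The two errors add up to \<open>2 * (N - m) / N\<close>; the contraction factor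
    \<open>1 / \<zeta>\<close>, at most one half, brings this down to the bound for
    \<open>Suc m\<close>.\<close>
  also have "\<dots> \<le> (2 * real N - 2 * real m) / real N / 2"
    using assms(1) Suc.prems by (intro divide_left_mono divide_nonneg_nonneg) auto
  also have "\<dots> = (real N + 1 - real (Suc m)) / real N"
    using N by (simp add: field_simps)
  finally show ?case using y by simp
qed

text \<open>The quotient telescopes into \<open>j\<close> consecutive ratios. Each has an index
  within bounded distance of \<open>n\<close>, where the preceding bound is of order
  \<open>1 / n\<close>.\<close>

lemma complete_partition_quotient_tendsto:
  assumes "\<zeta> \<ge> 40" "0 < r" "r \<le> 1" "r\<^sup>2 / \<zeta> = 1 - r" "\<And>n. lam n = 1 / (\<zeta> * real n)"
  shows "(\<lambda>n. complete_partition (lam n) (n - j) / complete_partition (lam n) n) \<longlonglongrightarrow> r ^ j"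
proof (induction j)
  case 0
  have "complete_partition (lam n) n \<noteq> 0" for n
    using complete_partition_pos[of "lam n" n] assms(1,5) by simp
  then show ?case by simp
next
  case (Suc j)
  let ?z = "\<lambda>n. complete_partition (lam n)"
  have pos: "?z n m > 0" for n m
    using complete_partition_pos[of "lam n"] assms(1,5) by simp
  have "(\<lambda>n. ?z n (n - Suc j) / ?z n (n - j) - r) \<longlonglongrightarrow> 0"
  proof (rule Lim_null_comparison)
    show "\<forall>\<^sub>F n in sequentially. norm (?z n (n - Suc j) / ?z n (n - j) - r) \<le> (2 + real j) / real n"
      using eventually_gt_at_top[of j]
    proof eventually_elim
      case (elim n)
      then have s: "n - j = Suc (n - Suc j)" by simp
      have "\<bar>?z n (n - Suc j) / ?z n (Suc (n - Suc j)) - r\<bar> \<le>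
          (real n + 1 - real (n - Suc j)) / real n"
        using elim by (intro complete_partition_ratio[OF assms(1-4)]) (auto simp: assms(5))
      also have "(real n + 1 - real (n - Suc j)) = 2 + real j"
        using elim by (simp add: of_nat_diff)
      finally show ?case unfolding s by simp
    qed
    show "(\<lambda>n. (2 + real j) / real n) \<longlonglongrightarrow> 0"
      by (rule lim_const_over_n)
  qed
  then have "(\<lambda>n. ?z n (n - Suc j) / ?z n (n - j)) \<longlonglongrightarrow> r"
    by (simp add: LIM_zero_iff)
  from tendsto_mult[OF this Suc.IH]
  show ?case using pos by (simp add: less_imp_neq[symmetric])
qed

section \<open>Numbers of edge sets and of matchings of a fixed size\<close>

lemma real_choose_two: "real (n choose 2) = real n * (real n - 1) / 2"
proof -
  have "even (n * (n - 1))" by (cases n) auto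
  then have "real (n choose 2) = real (n * (n - 1)) / 2"
    by (simp add: choose_two real_of_nat_div)
  then show ?thesis by (cases n) (auto simp: algebra_simps)
qed

text \<open>The falling factorial has \<open>k\<close> factors, each asymptotic to half of n
  squared.\<close>

lemma binomial_scaled_tendsto:
  "(\<lambda>n. real ((n choose 2) choose k) / real n ^ (2 * k)) \<longlonglongrightarrow> (1 / 2) ^ k / fact k"
proof -
  have eq: "real ((n choose 2) choose k) / real n ^ (2 * k) =
      (\<Prod>i<k. (real (n choose 2) - real i) / (real n)\<^sup>2) / fact k" for n
    by (simp add: binomial_gbinomial gbinomial_prod_rev prod_dividef power_mult atLeast0LessThan)
  have "(\<lambda>n. (real (n choose 2) - real i) / (real n)\<^sup>2) \<longlonglongrightarrow> 1 / 2" for i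
  proof -
    have "(\<lambda>n. (real n * (real n - 1) / 2 - real i) / (real n)\<^sup>2) \<longlonglongrightarrow> 1 / 2"
      by real_asymp
    then show ?thesis by (simp add: real_choose_two)
  qed
  then have "(\<lambda>n. (\<Prod>i<k. (real (n choose 2) - real i) / (real n)\<^sup>2) / fact k) \<longlonglongrightarrow>
      (\<Prod>i<k. 1 / 2) / fact k"
    by (intro tendsto_divide[OF tendsto_prod tendsto_const]) auto
  then show ?thesis unfolding eq by (simp add: power_one_over)
qed

text \<open>The limit agrees with that for all sets of \<open>k\<close> edges in
  \<open>binomial_scaled_tendsto\<close>, so all but a vanishing fraction of these sets are
  matchings. It follows by iterating the double count \<open>card_matchings_Suc\<close>.\<close>

lemma card_matchings_scaled_tendsto:
  "(\<lambda>n. real (card {M \<in> matchings (complete_edges n). card M = k}) / real n ^ (2 * k))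
     \<longlonglongrightarrow> (1 / 2) ^ k / fact k"
proof (induction k)
  case 0
  have "finite M" if "M \<in> matchings (complete_edges n)" for M n
    using that finite_pairs[of "{1..n}"]
    by (auto simp: matchings_def complete_edges_eq_pairs intro: finite_subset)
  then have "{M \<in> matchings (complete_edges n). card M = 0} = {{}}" for n
    by (auto simp: empty_in_matchings)
  then show ?case by (simp only:) simp
next
  case (Suc k)
  let ?m = "\<lambda>k n. real (card {M \<in> matchings (complete_edges n). card M = k})"
  have rec: "?m (Suc k) n = ?m k n * real (n - 2 * k choose 2) / real (Suc k)" for n
  proof -
    have "real (Suc k) * ?m (Suc k) n = ?m k n * real (n - 2 * k choose 2)"
      using arg_cong[OF card_matchings_Suc[of "{1..n}" k], of real]
      unfolding complete_edges_eq_pairs of_nat_mult by (simp del: of_nat_Suc)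
    then show ?thesis by (simp add: field_simps)
  qed
  have "(\<lambda>n. real (n - 2 * k choose 2) / (real n)\<^sup>2) \<longlonglongrightarrow> 1 / 2"
  proof -
    have "(\<lambda>n. ((real n - 2 * real k) * (real n - 2 * real k - 1) / 2) / (real n)\<^sup>2) \<longlonglongrightarrow> 1 / 2"
      by real_asymp
    moreover have "\<forall>\<^sub>F n in sequentially. ((real n - 2 * real k) * (real n - 2 * real k - 1) / 2) /
        (real n)\<^sup>2 = real (n - 2 * k choose 2) / (real n)\<^sup>2"
      using eventually_gt_at_top[of "2 * k"]
    proof eventually_elim
      case (elim n)
      then show ?case by (simp add: real_choose_two of_nat_diff)
    qed
    ultimately show ?thesis
      by (rule Lim_transform_eventually)
  qed
  from tendsto_mult[OF Suc.IH tendsto_divide[OF this tendsto_const[of "real (Suc k)"]]]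
  have "(\<lambda>n. ?m k n / real n ^ (2 * k) * (real (n - 2 * k choose 2) / (real n)\<^sup>2 / real (Suc k)))
      \<longlonglongrightarrow> (1 / 2) ^ k / fact k * (1 / 2 / real (Suc k))"
    by simp
  moreover have "?m (Suc k) n / real n ^ (2 * Suc k) =
      ?m k n / real n ^ (2 * k) * (real (n - 2 * k choose 2) / (real n)\<^sup>2 / real (Suc k))" for n
    unfolding rec by (simp add: power2_eq_square power_add mult.assoc)
  moreover have "(1 / 2) ^ k / fact k * (1 / 2 / real (Suc k)) = (1 / 2) ^ Suc k / fact (Suc k)"
    by (simp add: field_simps)
  ultimately show ?case by (simp only:)
qed

section \<open>Characteristic functions of tilted Bernoulli products\<close>

text \<open>With \<open>g\<close> the continuous extension of \<open>Ln x / (x - 1)\<close> to 1,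
  the power equals \<open>exp (N n * (u n - 1) * g (u n))\<close> as soon as \<open>u n\<close> is
  nonzero, and \<open>g (u n)\<close> tends to 1.\<close>

lemma power_tendsto_exp_complex:
  fixes u :: "nat \<Rightarrow> complex"
  assumes "u \<longlonglongrightarrow> 1" "(\<lambda>n. of_nat (N n) * (u n - 1)) \<longlonglongrightarrow> w"
  shows "(\<lambda>n. u n ^ N n) \<longlonglongrightarrow> exp w"
proof -
  define g :: "complex \<Rightarrow> complex" where "g x = (if x = 1 then 1 else Ln x / (x - 1))" for x
  have "(Ln has_field_derivative 1) (at 1)"
    using has_field_derivative_Ln[of 1] by simp
  then have "((\<lambda>x. Ln x / (x - 1)) \<longlongrightarrow> 1) (at 1)"
    by (simp add: has_field_derivative_iff)
  then have "(g \<longlongrightarrow> 1) (at 1)"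
    by (rule Lim_transform_eventually) (auto simp: g_def eventually_at_filter)
  then have "isCont g 1" by (simp add: isCont_def g_def)
  from isCont_tendsto_compose[OF this assms(1)] have "(\<lambda>n. g (u n)) \<longlonglongrightarrow> 1"
    by (simp add: g_def)
  from tendsto_mult[OF assms(2) this]
  have "(\<lambda>n. exp (of_nat (N n) * (u n - 1) * g (u n))) \<longlonglongrightarrow> exp w"
    by (intro tendsto_exp) simp
  moreover have "\<forall>\<^sub>F n in sequentially. exp (of_nat (N n) * (u n - 1) * g (u n)) = u n ^ N n"
  proof -
    have "\<forall>\<^sub>F n in sequentially. u n \<noteq> 0"
      using assms(1) by (rule tendsto_imp_eventually_ne) simp
    then show ?thesis
    proof eventually_elim
      case (elim n)
      have "(u n - 1) * g (u n) = Ln (u n)" by (simp add: g_def)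
      then have "exp (of_nat (N n) * (u n - 1) * g (u n)) = exp (of_nat (N n) * Ln (u n))"
        by (simp add: mult.assoc)
      also have "\<dots> = u n ^ N n" using elim by (simp add: exp_of_nat_mult)
      finally show ?case .
    qed
  qed
  ultimately show ?thesis by (rule Lim_transform_eventually)
qed

text \<open>The second-order term of the complex power \<open>(1 + a / n)\<close> to the
  \<open>z\<close>. The quadratic term of the logarithm contributes - z a^2 / 2 and that of the
  exponential z^2 a^2 / 2; the Taylor remainder is cubic in the logarithm.\<close>

lemma exp_ln_second_order:
  fixes z :: complex and a :: real
  shows "(\<lambda>n. of_real ((real n)\<^sup>2) * (exp (z * of_real (ln (1 + a / real n))) - 1
      - z * of_real (a / real n))) \<longlonglongrightarrow> z * (z - 1) * of_real (a\<^sup>2) / 2"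
proof -
  define l where "l n = ln (1 + a / real n)" for n
  define R where "R n = exp (z * of_real (l n)) - (\<Sum>k\<le>2. (z * of_real (l n)) ^ k / fact k)" for n
  have l1: "(\<lambda>n. (real n)\<^sup>2 * (l n - a / real n)) \<longlonglongrightarrow> - a\<^sup>2 / 2"
    unfolding l_def by (real_asymp simp: power2_eq_square)
  have "(\<lambda>n. real n * l n) \<longlonglongrightarrow> a"
    unfolding l_def by real_asymp
  then have l2: "(\<lambda>n. (real n)\<^sup>2 * (l n)\<^sup>2) \<longlonglongrightarrow> a\<^sup>2"
    unfolding power_mult_distrib[symmetric] by (rule tendsto_power)
  have l0: "l \<longlonglongrightarrow> 0"
    unfolding l_def by real_asymp
  have "(\<lambda>n. of_real ((real n)\<^sup>2) * R n) \<longlonglongrightarrow> 0"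
  proof (rule Lim_null_comparison)
    show "\<forall>\<^sub>F n in sequentially. norm (of_real ((real n)\<^sup>2) * R n) \<le>
        exp (norm z * \<bar>l n\<bar>) * (norm z) ^ 3 / 2 * ((real n)\<^sup>2 * (l n)\<^sup>2 * \<bar>l n\<bar>)"
    proof (rule always_eventually, rule allI)
      fix n
      have "norm (R n) \<le> exp \<bar>Re (z * of_real (l n))\<bar> * (norm (z * of_real (l n))) ^ Suc 2 / fact 2"
        unfolding R_def by (rule Taylor_exp)
      also have "\<dots> \<le> exp (norm (z * of_real (l n))) * (norm (z * of_real (l n))) ^ Suc 2 / fact 2"
        using abs_Re_le_cmod[of "z * of_real (l n)"]
        by (intro divide_right_mono mult_right_mono) auto
      also have "\<dots> = exp (norm z * \<bar>l n\<bar>) * (norm z) ^ 3 / 2 * ((l n)\<^sup>2 * \<bar>l n\<bar>)"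
        by (simp add: norm_mult power_mult_distrib power2_eq_square power3_eq_cube)
      finally have "(real n)\<^sup>2 * norm (R n) \<le>
          (real n)\<^sup>2 * (exp (norm z * \<bar>l n\<bar>) * (norm z) ^ 3 / 2 * ((l n)\<^sup>2 * \<bar>l n\<bar>))"
        by (intro mult_left_mono) auto
      then show "norm (of_real ((real n)\<^sup>2) * R n) \<le>
          exp (norm z * \<bar>l n\<bar>) * (norm z) ^ 3 / 2 * ((real n)\<^sup>2 * (l n)\<^sup>2 * \<bar>l n\<bar>)"
        by (simp add: norm_mult norm_power mult_ac)
    qed
    have "(\<lambda>n. exp (norm z * \<bar>l n\<bar>) * (norm z) ^ 3 / 2 * ((real n)\<^sup>2 * (l n)\<^sup>2 * \<bar>l n\<bar>))
        \<longlonglongrightarrow> exp (norm z * \<bar>0\<bar>) * (norm z) ^ 3 / 2 * (a\<^sup>2 * \<bar>0\<bar>)"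
      by (intro tendsto_mult tendsto_divide tendsto_exp tendsto_const tendsto_rabs l0 l2) simp
    then show "(\<lambda>n. exp (norm z * \<bar>l n\<bar>) * (norm z) ^ 3 / 2 * ((real n)\<^sup>2 * (l n)\<^sup>2 * \<bar>l n\<bar>))
        \<longlonglongrightarrow> 0" by simp
  qed
  then have "(\<lambda>n. z * of_real ((real n)\<^sup>2 * (l n - a / real n))
      + z\<^sup>2 / 2 * of_real ((real n)\<^sup>2 * (l n)\<^sup>2) + of_real ((real n)\<^sup>2) * R n)
      \<longlonglongrightarrow> z * of_real (- a\<^sup>2 / 2) + z\<^sup>2 / 2 * of_real (a\<^sup>2) + 0"
    by (intro tendsto_add tendsto_mult tendsto_const tendsto_of_real l1 l2)
  moreover have "z * of_real ((real n)\<^sup>2 * (l n - a / real n))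
      + z\<^sup>2 / 2 * of_real ((real n)\<^sup>2 * (l n)\<^sup>2) + of_real ((real n)\<^sup>2) * R n =
      of_real ((real n)\<^sup>2) * (exp (z * of_real (l n)) - 1 - z * of_real (a / real n))" for n
    by (simp add: R_def numeral_2_eq_2 algebra_simps power_mult_distrib add_divide_distrib)
  moreover have "z * of_real (- a\<^sup>2 / 2) + z\<^sup>2 / 2 * of_real (a\<^sup>2) + 0 =
      z * (z - 1) * of_real (a\<^sup>2) / 2"
    by (simp add: power2_eq_square algebra_simps diff_divide_distrib)
  ultimately show ?thesis by (simp only: l_def)
qed

lemma choose_two_over_square: "(\<lambda>n. real (n choose 2) / (real n)\<^sup>2) \<longlonglongrightarrow> 1 / 2"
  unfolding real_choose_two by real_asymp

text \<open>The base is the null expectation of the \<open>z\<close>-th power of one factor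
  \<open>1 + c / n * y\<close>. Since \<open>y\<close> has mean 0, the first-order terms cancel. Its
  variance \<open>(1 - p) / p\<close> enters the second-order term, and the exponent
  \<open>n choose 2\<close> supplies another factor n^2 / 2.\<close>

lemma tilted_bernoulli_power_tendsto:
  fixes z :: complex and p c :: real
  assumes "0 < p" "p < 1"
  shows "(\<lambda>n. (of_real p * exp (z * of_real (ln (1 + c * ((1 - p) / p) / real n)))
      + of_real (1 - p) * exp (z * of_real (ln (1 + - c / real n)))) ^ (n choose 2))
    \<longlonglongrightarrow> exp (of_real (c\<^sup>2 / 4 * ((1 - p) / p)) * (z * (z - 1)))"
    (is "(\<lambda>n. ?u n ^ _) \<longlonglongrightarrow> exp ?w")
proof (rule power_tendsto_exp_complex)
  define s where "s = (1 - p) / p"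
  have ps: "p * s = 1 - p" using assms by (simp add: s_def)
  define h where "h a n = exp (z * of_real (ln (1 + a / real n))) - 1 - z * of_real (a / real n)" for a n
  have u: "?u n - 1 = of_real p * h (c * s) n + of_real (1 - p) * h (- c) n" for n
  proof -
    have "of_real p * (z * of_real (c * s / real n)) + of_real (1 - p) * (z * of_real (- c / real n))
        = z * of_real (p * (c * s / real n) + (1 - p) * (- c / real n))"
      by (simp only: of_real_add of_real_mult) (simp only: algebra_simps)
    also have "p * (c * s / real n) + (1 - p) * (- c / real n) = 0"
      unfolding ps[symmetric] by simp
    finally show ?thesis
      unfolding h_def s_def[symmetric] by (simp add: algebra_simps)
  qed
  have "(\<lambda>n. of_real (real (n choose 2) / (real n)\<^sup>2) *
      (of_real p * (of_real ((real n)\<^sup>2) * h (c * s) n) + of_real (1 - p) * (of_real ((real n)\<^sup>2) * h (- c) n)))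
      \<longlonglongrightarrow> of_real (1 / 2) * (of_real p * (z * (z - 1) * of_real ((c * s)\<^sup>2) / 2)
        + of_real (1 - p) * (z * (z - 1) * of_real ((- c)\<^sup>2) / 2))"
    unfolding h_def
    by (intro tendsto_mult tendsto_add tendsto_const tendsto_of_real choose_two_over_square
        exp_ln_second_order)
  also have "of_real (1 / 2) * (of_real p * (z * (z - 1) * of_real ((c * s)\<^sup>2) / 2)
        + of_real (1 - p) * (z * (z - 1) * of_real ((- c)\<^sup>2) / 2))
      = of_real (c\<^sup>2 / 4 * (p * s * s + (1 - p))) * (z * (z - 1))"
    by (simp add: power2_eq_square field_simps)
  also have "p * s * s + (1 - p) = s"
    unfolding ps using assms by (simp add: s_def field_simps)
  finally have lim: "(\<lambda>n. of_real (real (n choose 2) / (real n)\<^sup>2) *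
      (of_real p * (of_real ((real n)\<^sup>2) * h (c * s) n) + of_real (1 - p) * (of_real ((real n)\<^sup>2) * h (- c) n)))
      \<longlonglongrightarrow> ?w" by (simp only: s_def)
  have "\<forall>\<^sub>F n in sequentially. of_real (real (n choose 2) / (real n)\<^sup>2) *
      (of_real p * (of_real ((real n)\<^sup>2) * h (c * s) n) + of_real (1 - p) * (of_real ((real n)\<^sup>2) * h (- c) n))
      = of_nat (n choose 2) * (?u n - 1)"
    using eventually_gt_at_top[of 0]
  proof eventually_elim
    case (elim n)
    then show ?case unfolding u by (simp add: field_simps)
  qed
  with lim show *: "(\<lambda>n. of_nat (n choose 2) * (?u n - 1)) \<longlonglongrightarrow> ?w"
    by (rule Lim_transform_eventually)
  \<comment> \<open>Convergence of the base to 1 follows from the limit just shown, on division by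
    the diverging exponent.\<close>
  have "(\<lambda>n. 1 / real (n choose 2)) \<longlonglongrightarrow> 0"
    unfolding real_choose_two by real_asymp
  from tendsto_mult[OF tendsto_of_real[OF this] *]
  have "(\<lambda>n. of_real (1 / real (n choose 2)) * (of_nat (n choose 2) * (?u n - 1))) \<longlonglongrightarrow> 0"
    by simp
  moreover have "\<forall>\<^sub>F n in sequentially.
      of_real (1 / real (n choose 2)) * (of_nat (n choose 2) * (?u n - 1)) = ?u n - 1"
    using eventually_ge_at_top[of 2]
  proof eventually_elim
    case (elim n)
    then have "n choose 2 \<noteq> 0" by simp
    then show ?case by simp
  qed
  ultimately have "(\<lambda>n. ?u n - 1) \<longlonglongrightarrow> 0"
    by (rule Lim_transform_eventually)
  then show "?u \<longlonglongrightarrow> 1" by (simp add: LIM_zero_iff)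
qed

section \<open>Second moments of multilinear polynomials\<close>

lemma expectation_pmf_finite:
  fixes f :: "'a \<Rightarrow> 'b::{banach, second_countable_topology}"
  assumes "finite (set_pmf M)"
  shows "measure_pmf.expectation M f = (\<Sum>a\<in>set_pmf M. pmf M a *\<^sub>R f a)"
  by (rule integral_measure_pmf[OF assms])

text \<open>Finite support makes every function integrable and turns expectations into finite
  sums.\<close>

lemma finite_set_Pi_pmf_bool:
  fixes p :: "'a \<Rightarrow> bool pmf"
  assumes "finite E"
  shows "finite (set_pmf (Pi_pmf E d p))"
  using assms by (simp add: set_Pi_pmf finite_PiE_dflt)

text \<open>Independence of the coordinates. The codomain is a general normed field because real
  products are needed for orthogonality and complex ones for characteristic functions.\<close>

lemma expectation_prod_bernoulli:
  fixes f :: "'a \<Rightarrow> bool \<Rightarrow> 'b::{real_normed_field, banach, second_countable_topology}"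
  assumes "finite E" "0 \<le> p" "p \<le> 1"
  shows "measure_pmf.expectation (Pi_pmf E d (\<lambda>_. bernoulli_pmf p)) (\<lambda>A. \<Prod>e\<in>E. f e (A e)) =
    (\<Prod>e\<in>E. of_real p * f e True + of_real (1 - p) * f e False)"
proof -
  let ?Q = "Pi_pmf E d (\<lambda>_. bernoulli_pmf p)"
  let ?E = "measure_pmf.expectation ?Q"
  have "prob_space.indep_vars ?Q (\<lambda>_. borel) (\<lambda>e A. f e (A e)) E"
    by (rule prob_space.indep_vars_compose2[OF prob_space_measure_pmf indep_vars_Pi_pmf[OF assms(1)]]) simp
  then have "?E (\<lambda>A. \<Prod>e\<in>E. f e (A e)) = (\<Prod>e\<in>E. ?E (\<lambda>A. f e (A e)))"
    by (rule prob_space.indep_vars_lebesgue_integral[OF prob_space_measure_pmf assms(1)])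
      (intro integrable_measure_pmf_finite finite_set_Pi_pmf_bool assms)
  also have "\<dots> = (\<Prod>e\<in>E. of_real p * f e True + of_real (1 - p) * f e False)"
  proof (rule prod.cong)
    fix e assume e: "e \<in> E"
    have "?E (\<lambda>A. f e (A e)) =
        measure_pmf.expectation (map_pmf (\<lambda>A. A e) ?Q) (f e)"
      by simp
    also have "map_pmf (\<lambda>A. A e) ?Q = bernoulli_pmf p"
      using e assms by (simp add: Pi_pmf_component)
    also have "measure_pmf.expectation (bernoulli_pmf p) (f e) =
        (\<Sum>b\<in>UNIV. pmf (bernoulli_pmf p) b *\<^sub>R f e b)"
      by (rule integral_measure_pmf) auto
    also have "\<dots> = of_real p * f e True + of_real (1 - p) * f e False"
      using assms by (simp add: UNIV_bool scaleR_conv_of_real)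
    finally show "?E (\<lambda>A. f e (A e)) = of_real p * f e True + of_real (1 - p) * f e False" .
  qed simp
  finally show ?thesis .
qed

text \<open>Parseval's identity: products of centred variables over different sets are orthogonal,
  because an edge lying in exactly one of the sets contributes a factor of mean 0.\<close>

lemma second_moment_multilinear:
  fixes y :: "bool \<Rightarrow> real"
  assumes "finite E" "0 \<le> p" "p \<le> 1"
    and mean: "p * y True + (1 - p) * y False = 0"
    and var: "p * (y True)\<^sup>2 + (1 - p) * (y False)\<^sup>2 = s"
  shows "measure_pmf.expectation (Pi_pmf E d (\<lambda>_. bernoulli_pmf p))
      (\<lambda>A. (\<Sum>S\<in>Pow E. b S * (\<Prod>e\<in>S. y (A e)))\<^sup>2) = (\<Sum>S\<in>Pow E. s ^ card S * (b S)\<^sup>2)"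
proof -
  let ?Q = "Pi_pmf E d (\<lambda>_. bernoulli_pmf p)"
  let ?E = "measure_pmf.expectation ?Q"
  have int: "integrable (measure_pmf ?Q) f" for f :: "_ \<Rightarrow> real"
    by (intro integrable_measure_pmf_finite finite_set_Pi_pmf_bool assms)
  have orth: "?E (\<lambda>A. (\<Prod>e\<in>S. y (A e)) * (\<Prod>e\<in>T. y (A e))) = (if S = T then s ^ card S else 0)"
    if ST: "S \<subseteq> E" "T \<subseteq> E" for S T
  proof -
    \<comment> \<open>Padding by factors 1 lets both products run over all of \<open>E\<close>, so
      that independence yields one factor per edge.\<close>
    define f where "f e x = (if e \<in> S then y x else 1) * (if e \<in> T then y x else 1)" for e x
    have "(\<Prod>e\<in>S. y (A e)) * (\<Prod>e\<in>T. y (A e)) = (\<Prod>e\<in>E. f e (A e))" for A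
      unfolding f_def prod.distrib
      using ST assms(1) by (simp add: prod.If_cases Int_absorb1)
    then have "?E (\<lambda>A. (\<Prod>e\<in>S. y (A e)) * (\<Prod>e\<in>T. y (A e))) =
        (\<Prod>e\<in>E. p * f e True + (1 - p) * f e False)"
      using expectation_prod_bernoulli[OF assms(1-3), of d f] by simp
    also have "\<dots> = (if S = T then s ^ card S else 0)"
    proof (cases "S = T")
      case True
      then have "(\<Prod>e\<in>E. p * f e True + (1 - p) * f e False) = (\<Prod>e\<in>E. if e \<in> S then s else 1)"
        using var by (intro prod.cong) (auto simp: f_def power2_eq_square)
      also have "\<dots> = s ^ card S"
        using ST assms(1) by (simp add: prod.If_cases Int_absorb1)
      finally show ?thesis using True by simp
    next
      case False
      then obtain e where e: "e \<in> E" "(e \<in> S) \<noteq> (e \<in> T)" using ST by blast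
      then have "p * f e True + (1 - p) * f e False = 0"
        using mean by (auto simp: f_def)
      then show ?thesis using e(1) False assms(1) by (auto intro: prod_zero)
    qed
    finally show ?thesis .
  qed
  have "?E (\<lambda>A. (\<Sum>S\<in>Pow E. b S * (\<Prod>e\<in>S. y (A e)))\<^sup>2) =
      ?E (\<lambda>A. \<Sum>S\<in>Pow E. \<Sum>T\<in>Pow E. b S * b T * ((\<Prod>e\<in>S. y (A e)) * (\<Prod>e\<in>T. y (A e))))"
    by (simp add: power2_eq_square sum_product mult_ac)
  also have "\<dots> = (\<Sum>S\<in>Pow E. \<Sum>T\<in>Pow E. b S * b T * ?E (\<lambda>A. (\<Prod>e\<in>S. y (A e)) * (\<Prod>e\<in>T. y (A e))))"
    by (simp add: Bochner_Integration.integral_sum int)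
  also have "\<dots> = (\<Sum>S\<in>Pow E. \<Sum>T\<in>Pow E. if S = T then b S * b T * s ^ card S else 0)"
    by (intro sum.cong refl) (simp add: orth)
  also have "\<dots> = (\<Sum>S\<in>Pow E. s ^ card S * (b S)\<^sup>2)"
    using assms(1) by (simp add: power2_eq_square mult_ac)
  finally show ?thesis .
qed

text \<open>Cauchy-Schwarz, reduced to finite sums by splitting each weight into two square
  roots.\<close>

lemma expectation_mult_le_sqrt:
  fixes X Y :: "'a \<Rightarrow> real"
  assumes "finite (set_pmf M)"
  shows "measure_pmf.expectation M (\<lambda>a. \<bar>X a\<bar> * \<bar>Y a\<bar>) \<le>
    sqrt (measure_pmf.expectation M (\<lambda>a. (X a)\<^sup>2)) * sqrt (measure_pmf.expectation M (\<lambda>a. (Y a)\<^sup>2))"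
proof -
  have "(\<Sum>a\<in>set_pmf M. pmf M a * (\<bar>X a\<bar> * \<bar>Y a\<bar>)) =
      (\<Sum>a\<in>set_pmf M. \<bar>sqrt (pmf M a) * X a\<bar> * \<bar>sqrt (pmf M a) * Y a\<bar>)"
  proof (rule sum.cong)
    fix a
    have "\<bar>sqrt (pmf M a) * X a\<bar> * \<bar>sqrt (pmf M a) * Y a\<bar> =
        (sqrt (pmf M a) * sqrt (pmf M a)) * (\<bar>X a\<bar> * \<bar>Y a\<bar>)"
      by (simp only: abs_mult real_sqrt_abs abs_of_nonneg[OF real_sqrt_ge_zero[OF pmf_nonneg]] mult_ac)
    then show "pmf M a * (\<bar>X a\<bar> * \<bar>Y a\<bar>) = \<bar>sqrt (pmf M a) * X a\<bar> * \<bar>sqrt (pmf M a) * Y a\<bar>"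
      by simp
  qed simp
  also have "\<dots> \<le> L2_set (\<lambda>a. sqrt (pmf M a) * X a) (set_pmf M) *
      L2_set (\<lambda>a. sqrt (pmf M a) * Y a) (set_pmf M)"
    by (rule L2_set_mult_ineq)
  finally show ?thesis
    by (simp add: expectation_pmf_finite[OF assms] L2_set_def power_mult_distrib)
qed

section \<open>Lipschitz bounds for imaginary powers\<close>

lemma iexp_diff_le: "cmod (exp (\<i> * of_real a) - exp (\<i> * of_real b)) \<le> \<bar>a - b\<bar>"
proof -
  have "exp (\<i> * of_real a) - exp (\<i> * of_real b) =
      exp (\<i> * of_real b) * (exp (\<i> * of_real (a - b)) - 1)"
    by (simp add: algebra_simps flip: exp_add)
  then have "cmod (exp (\<i> * of_real a) - exp (\<i> * of_real b)) = cmod (exp (\<i> * of_real (a - b)) - 1)"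
    by (simp add: norm_mult)
  also have "\<dots> \<le> \<bar>a - b\<bar>"
    using iexp_approx1[of "a - b" 0] by simp
  finally show ?thesis .
qed

text \<open>The prefactor compensates the steepness of the logarithm near 0: for
  \<open>y \<le> x\<close>, the difference of the logarithms is at most \<open>x / y - 1\<close>,
  and multiplication by the smaller argument \<open>y\<close> leaves \<open>x - y\<close>.\<close>

lemma mult_iexp_ln_lipschitz:
  fixes x y t :: real
  assumes "x > 0" "y > 0"
  shows "cmod (of_real x * exp (\<i> * of_real (t * ln x)) - of_real y * exp (\<i> * of_real (t * ln y))) \<le>
    (1 + \<bar>t\<bar>) * \<bar>x - y\<bar>"
  using assms
proof (induction y x rule: linorder_wlog)
  case (le y x)
  let ?e = "\<lambda>x. exp (\<i> * of_real (t * ln x))"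
  have "of_real x * ?e x - of_real y * ?e y = of_real (x - y) * ?e x + of_real y * (?e x - ?e y)"
    by (simp add: algebra_simps)
  also have "cmod \<dots> \<le> cmod (of_real (x - y) * ?e x) + cmod (of_real y * (?e x - ?e y))"
    by (rule norm_triangle_ineq)
  also have "\<dots> = \<bar>x - y\<bar> + y * cmod (?e x - ?e y)"
    using le by (simp only: norm_mult norm_of_real norm_exp_i_times) simp
  also have "\<dots> \<le> \<bar>x - y\<bar> + \<bar>t\<bar> * \<bar>x - y\<bar>"
  proof -
    have "cmod (?e x - ?e y) \<le> \<bar>t * ln x - t * ln y\<bar>"
      by (rule iexp_diff_le)
    also have "\<dots> = \<bar>t\<bar> * \<bar>ln x - ln y\<bar>"
      by (simp only: right_diff_distrib[symmetric] abs_mult)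
    also have "\<dots> \<le> \<bar>t\<bar> * (x / y - 1)"
      using le ln_le_minus_one[of "x / y"] by (intro mult_left_mono) (simp_all add: ln_div)
    finally have "y * cmod (?e x - ?e y) \<le> y * (\<bar>t\<bar> * (x / y - 1))"
      using le by (intro mult_left_mono) auto
    also have "\<dots> = \<bar>t\<bar> * \<bar>x - y\<bar>"
      using le by (simp add: field_simps)
    finally show ?thesis by simp
  qed
  finally show ?case by (simp add: algebra_simps)
next
  case (sym a b)
  then show ?case by (simp add: norm_minus_commute abs_minus_commute)
qed

section \<open>Likelihood ratios\<close>

text \<open>This is \<open>b / p - 1\<close> with \<open>b\<close> read as 0 or 1. Adding 1 gives
  the likelihood ratio of a planted edge against \<open>bernoulli_pmf p\<close>.\<close>

definition centred_obs :: "real \<Rightarrow> bool \<Rightarrow> real" where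
  "centred_obs p b = (if b then (1 - p) / p else - 1)"

text \<open>The density of the planted model with respect to the null model: an average over the
  planted matching of products of single-edge likelihood ratios.\<close>

definition planted_ratio :: "real \<Rightarrow> real \<Rightarrow> 'v set set \<Rightarrow> ('v set \<Rightarrow> bool) \<Rightarrow> real" where
  "planted_ratio p lam E A = (\<Sum>M\<in>matchings E.
     lam ^ card M / matching_partition_function lam E * (\<Prod>e\<in>M. 1 + centred_obs p (A e)))"

text \<open>For \<open>a\<close> between 0 and 1 this is the likelihood ratio of independent edges
  of probability \<open>p + a * (1 - p)\<close> against independent edges of probability
  \<open>p\<close>.\<close>

definition tilted_ratio :: "real \<Rightarrow> real \<Rightarrow> 'v set set \<Rightarrow> ('v set \<Rightarrow> bool) \<Rightarrow> real" where
  "tilted_ratio p a E A = (\<Prod>e\<in>E. 1 + a * centred_obs p (A e))"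

definition containment_prob :: "real \<Rightarrow> 'v set set \<Rightarrow> 'v set set \<Rightarrow> real" where
  "containment_prob lam E S =
     (\<Sum>M | M \<in> matchings E \<and> S \<subseteq> M. lam ^ card M / matching_partition_function lam E)"

section \<open>Density of the planted model with respect to the null model\<close>

lemma finite_complete_edges: "finite (complete_edges n)"
  by (simp add: complete_edges_eq_pairs finite_pairs)

lemma matching_partition_function_pos:
  assumes "finite E" "lam \<ge> 0"
  shows "matching_partition_function lam E > 0"
proof -
  have "lam ^ card ({} :: 'a set set) \<le> matching_partition_function lam E"
    unfolding matching_partition_function_def
    by (rule member_le_sum[OF empty_in_matchings]) (use assms finite_matchings in auto)
  then show ?thesis by simp
qed

text \<open>Terms of nonempty matchings may vanish, but the empty matching always contributes the
  inverse of the partition function.\<close>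

lemma planted_ratio_pos:
  assumes "finite E" "lam \<ge> 0" "0 < p" "p < 1"
  shows "planted_ratio p lam E A > 0"
proof -
  let ?Z = "matching_partition_function lam E"
  let ?f = "\<lambda>M. lam ^ card M / ?Z * (\<Prod>e\<in>M. 1 + centred_obs p (A e))"
  have Z: "?Z > 0" using assms by (intro matching_partition_function_pos)
  have y: "0 \<le> 1 + centred_obs p b" for b
    using assms by (simp add: centred_obs_def)
  have f: "?f M \<ge> 0" for M
    using Z assms(2) by (intro mult_nonneg_nonneg divide_nonneg_nonneg prod_nonneg y) auto
  have "?f {} \<le> planted_ratio p lam E A"
    unfolding planted_ratio_def
    by (intro member_le_sum finite_matchings empty_in_matchings assms f)
  then show ?thesis using Z by (auto intro: less_le_trans[rotated])
qed

text \<open>Given the matching, the density is the product of the single-edge likelihood ratios over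
  its edges; averaging over the matching gives \<open>planted_ratio\<close>. Off the support of the
  product measures both sides are 0.\<close>

lemma pmf_planted_model:
  assumes "0 < p" "p < 1" "lam \<ge> 0"
  shows "pmf (planted_model n p lam) A =
    pmf (null_model n p) A * planted_ratio p lam (complete_edges n) A"
proof -
  let ?E = "complete_edges n" and ?Z = "matching_partition_function lam (complete_edges n)"
  let ?Q = "null_model n p"
  let ?P = "\<lambda>M. Pi_pmf ?E False (\<lambda>e. if e \<in> M then return_pmf True else bernoulli_pmf p)"
  have fin: "finite ?E" by (rule finite_complete_edges)
  note md = pmf_monomer_dimer[OF fin assms(3)]
  have cond: "pmf (?P M) A = pmf ?Q A * (\<Prod>e\<in>M. 1 + centred_obs p (A e))" if "M \<subseteq> ?E" for M
  proof (cases "\<forall>x. x \<notin> ?E \<longrightarrow> A x = False")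
    case True
    have "pmf (?P M) A = (\<Prod>e\<in>?E. pmf (if e \<in> M then return_pmf True else bernoulli_pmf p) (A e))"
      using True by (simp add: pmf_Pi[OF fin])
    also have "\<dots> = (\<Prod>e\<in>?E. pmf (bernoulli_pmf p) (A e) *
        (if e \<in> M then 1 + centred_obs p (A e) else 1))"
    proof (rule prod.cong)
      fix e
      show "pmf (if e \<in> M then return_pmf True else bernoulli_pmf p) (A e) =
          pmf (bernoulli_pmf p) (A e) * (if e \<in> M then 1 + centred_obs p (A e) else 1)"
        using assms by (cases "A e") (auto simp: centred_obs_def field_simps)
    qed simp
    also have "\<dots> = pmf ?Q A * (\<Prod>e\<in>M. 1 + centred_obs p (A e))"
      using True that fin unfolding prod.distrib
      by (simp add: null_model_def pmf_Pi prod.If_cases Int_absorb1)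
    finally show ?thesis .
  next
    case False
    then show ?thesis by (auto simp: null_model_def pmf_Pi[OF fin])
  qed
  have "pmf (planted_model n p lam) A =
      (\<Sum>M\<in>matchings ?E. pmf (monomer_dimer lam ?E) M *\<^sub>R pmf (?P M) A)"
    unfolding planted_model_def pmf_bind
    by (rule integral_measure_pmf) (auto simp: finite_matchings fin set_pmf_iff md split: if_splits)
  also have "\<dots> = (\<Sum>M\<in>matchings ?E. pmf ?Q A *
      (lam ^ card M / ?Z * (\<Prod>e\<in>M. 1 + centred_obs p (A e))))"
    by (intro sum.cong refl) (simp add: md cond matchings_def)
  finally show ?thesis by (simp add: planted_ratio_def sum_distrib_left)
qed

text \<open>The Radon-Nikodym derivative is determined only almost everywhere, which for a pmf means
  at every point of its support.\<close>

lemma log_likelihood_ratio_pmf: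
  assumes dens: "\<And>A. pmf P A = pmf Q A * f A" and nonneg: "\<And>A. f A \<ge> 0"
    and A: "A \<in> set_pmf Q"
  shows "log_likelihood_ratio P Q A = ln (f A)"
proof -
  have "measure_pmf P = density (count_space UNIV) (\<lambda>A. ennreal (pmf Q A) * ennreal (f A))"
    by (simp add: measure_pmf_eq_density[of P] dens ennreal_mult nonneg)
  also have "\<dots> = density (measure_pmf Q) (\<lambda>A. ennreal (f A))"
    by (subst measure_pmf_eq_density[of Q], subst density_density_eq) auto
  finally have "density (measure_pmf Q) (\<lambda>A. ennreal (f A)) = measure_pmf P" ..
  then have "AE A in measure_pmf Q. ennreal (f A) = RN_deriv (measure_pmf Q) (measure_pmf P) A"
    by (intro measure_pmf.RN_deriv_unique) auto
  then have "RN_deriv (measure_pmf Q) (measure_pmf P) A = ennreal (f A)"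
    using A by (auto simp: AE_measure_pmf_iff)
  then show ?thesis by (simp add: log_likelihood_ratio_def nonneg)
qed

text \<open>Each product over \<open>M\<close> expands into a sum over the subsets \<open>S\<close>
  of \<open>M\<close>; exchanging the sums collects the weights of all matchings that contain
  \<open>S\<close>.\<close>

lemma planted_ratio_expansion:
  assumes "finite E"
  shows "planted_ratio p lam E A =
    (\<Sum>S\<in>Pow E. containment_prob lam E S * (\<Prod>e\<in>S. centred_obs p (A e)))"
proof -
  let ?w = "\<lambda>M. lam ^ card M / matching_partition_function lam E"
  let ?y = "\<lambda>S. \<Prod>e\<in>S. centred_obs p (A e)"
  have "planted_ratio p lam E A = (\<Sum>M\<in>matchings E. \<Sum>S | S \<in> Pow E \<and> S \<subseteq> M. ?w M * ?y S)"
    unfolding planted_ratio_def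
  proof (rule sum.cong)
    fix M assume M: "M \<in> matchings E"
    then have "finite M" using assms by (auto simp: matchings_def intro: finite_subset)
    then have "(\<Prod>e\<in>M. centred_obs p (A e) + 1) = (\<Sum>S\<in>Pow M. ?y S)"
      by (subst prod_add) auto
    also have "Pow M = {S. S \<in> Pow E \<and> S \<subseteq> M}" using M by (auto simp: matchings_def)
    finally show "?w M * (\<Prod>e\<in>M. 1 + centred_obs p (A e)) =
        (\<Sum>S | S \<in> Pow E \<and> S \<subseteq> M. ?w M * ?y S)"
      by (simp add: sum_distrib_left add.commute)
  qed simp
  also have "\<dots> = (\<Sum>S\<in>Pow E. \<Sum>M | M \<in> matchings E \<and> S \<subseteq> M. ?w M * ?y S)"
    by (rule sum.swap_restrict) (use assms finite_matchings in auto)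
  finally show ?thesis by (simp add: containment_prob_def sum_distrib_right)
qed

lemma tilted_ratio_expansion:
  assumes "finite E"
  shows "tilted_ratio p a E A = (\<Sum>S\<in>Pow E. a ^ card S * (\<Prod>e\<in>S. centred_obs p (A e)))"
proof -
  have "tilted_ratio p a E A = (\<Prod>e\<in>E. a * centred_obs p (A e) + 1)"
    by (simp add: tilted_ratio_def add.commute)
  also have "\<dots> = (\<Sum>S\<in>Pow E. \<Prod>e\<in>S. a * centred_obs p (A e))"
    using assms by (subst prod_add) auto
  finally show ?thesis by (simp add: prod.distrib)
qed

text \<open>Both ratios are multilinear in the same centred observations, so Parseval reduces their
  distance to that of their coefficients.\<close>

lemma expectation_ratio_diff_square:
  assumes "0 < p" "p < 1"
  shows "measure_pmf.expectation (null_model n p)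
      (\<lambda>A. (planted_ratio p lam (complete_edges n) A - tilted_ratio p a (complete_edges n) A)\<^sup>2) =
    (\<Sum>S\<in>Pow (complete_edges n).
      ((1 - p) / p) ^ card S * (containment_prob lam (complete_edges n) S - a ^ card S)\<^sup>2)"
proof -
  have "p * centred_obs p True + (1 - p) * centred_obs p False = 0"
    using assms by (simp add: centred_obs_def)
  moreover have "p * (centred_obs p True)\<^sup>2 + (1 - p) * (centred_obs p False)\<^sup>2 = (1 - p) / p"
    using assms by (simp add: centred_obs_def field_simps power2_eq_square)
  ultimately show ?thesis
    unfolding null_model_def
    using second_moment_multilinear[OF finite_complete_edges, of p "centred_obs p", where d = False
        and b = "\<lambda>S. containment_prob lam (complete_edges n) S - a ^ card S"] assms
    by (simp add: planted_ratio_expansion tilted_ratio_expansion finite_complete_edges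
        sum_subtractf left_diff_distrib)
qed

section \<open>Containment probabilities and the distance between the two ratios\<close>

lemma containment_prob_matching:
  assumes "S \<in> matchings (complete_edges n)"
  shows "containment_prob lam (complete_edges n) S =
    lam ^ card S * (complete_partition lam (n - 2 * card S) / complete_partition lam n)"
proof -
  have S: "S \<in> matchings (pairs {1..n})" using assms by (simp add: complete_edges_eq_pairs)
  have "\<Union>S \<subseteq> {1..n}" using S by (auto simp: matchings_def pairs_def)
  then have "card ({1..n} - \<Union>S) = n - 2 * card S"
    using card_Union_matching[OF _ S] by (simp add: card_Diff_subset finite_subset)
  moreover have "matching_partition_function lam (pairs {1..n}) = complete_partition lam n"
    using matching_partition_function_pairs[of "{1..n}" lam] by simp
  moreover have "matching_partition_function lam (pairs ({1..n} - \<Union>S)) =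
      complete_partition lam (card ({1..n} - \<Union>S))"
    by (rule matching_partition_function_pairs) simp
  ultimately show ?thesis
    unfolding containment_prob_def complete_edges_eq_pairs sum_divide_distrib[symmetric]
      sum_matchings_superset[OF finite_atLeastAtMost S] by simp
qed

lemma containment_prob_nonmatching:
  "S \<notin> matchings E \<Longrightarrow> containment_prob lam E S = 0"
  by (auto simp: containment_prob_def intro!: sum.neutral dest: matchings_subset)

text \<open>The coefficient sum is split into layers \<open>T k n\<close> by the size
  \<open>k\<close> of \<open>S\<close>. Every fixed layer vanishes in the limit, and a summable
  bound that does not depend on \<open>n\<close> allows the sum and the limit to be
  exchanged.\<close>

lemma ratio_diff_square_tendsto_0:
  assumes p: "0 < p" "p < 1" and "\<zeta> \<ge> 40" "0 < r" "r \<le> 1" "r\<^sup>2 / \<zeta> = 1 - r"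
    and lam: "\<And>n. lam n = 1 / (\<zeta> * real n)"
  shows "(\<lambda>n. measure_pmf.expectation (null_model n p)
      (\<lambda>A. (planted_ratio p (lam n) (complete_edges n) A -
        tilted_ratio p ((1 - r) / real n) (complete_edges n) A)\<^sup>2)) \<longlonglongrightarrow> 0"
proof -
  define c s where "c = 1 - r" and "s = (1 - p) / p"
  have s: "s \<ge> 0" using p by (simp add: s_def)
  have c: "0 \<le> c" "c \<le> 1" using assms by (auto simp: c_def)
  let ?E = complete_edges
  let ?z = "\<lambda>n. complete_partition (lam n)"
  have pos: "?z n m > 0" for n m
    using complete_partition_pos[of "lam n"] assms by simp
  define \<alpha> where "\<alpha> k n = lam n ^ k * (?z n (n - 2 * k) / ?z n n)" for k n
  define g where "g n S = s ^ card S * (containment_prob (lam n) (?E n) S - (c / real n) ^ card S)\<^sup>2" for n S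
  define T where "T k n = sum (g n) {S \<in> Pow (?E n). card S = k}" for k n
  define m where "m k n = real (card {M \<in> matchings (?E n). card M = k})" for k n
  define C where "C k n = real ((n choose 2) choose k)" for k n
  have card_E: "card (?E n) = n choose 2" for n
    by (simp add: complete_edges_eq_pairs card_pairs)
  have card_k: "real (card {S \<in> Pow (?E n). card S = k}) = C k n" for k n
    using n_subsets[OF finite_complete_edges, of n k] by (simp add: C_def card_E)
  \<comment> \<open>Within a layer, all matchings share the coefficient \<open>\<alpha> k n\<close>,
    while all other sets have coefficient 0 in the planted ratio.\<close>
  have T_eq: "T k n = s ^ k * (m k n * (\<alpha> k n - (c / real n) ^ k)\<^sup>2 + (C k n - m k n) * ((c / real n) ^ k)\<^sup>2)"
    for k n
  proof -
    let ?A = "{S \<in> Pow (?E n). card S = k}" and ?B = "{M \<in> matchings (?E n). card M = k}"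
    have fin: "finite ?A" by (simp add: finite_complete_edges)
    have sub: "?B \<subseteq> ?A" by (auto simp: matchings_def)
    have "T k n = sum (g n) (?A - ?B) + sum (g n) ?B"
      unfolding T_def by (rule sum.subset_diff[OF sub fin])
    also have "sum (g n) ?B = (\<Sum>S\<in>?B. s ^ k * (\<alpha> k n - (c / real n) ^ k)\<^sup>2)"
      by (intro sum.cong refl) (auto simp: g_def \<alpha>_def containment_prob_matching)
    also have "sum (g n) (?A - ?B) = (\<Sum>S\<in>?A - ?B. s ^ k * ((c / real n) ^ k)\<^sup>2)"
      by (intro sum.cong refl) (auto simp: g_def containment_prob_nonmatching)
    also have "\<dots> = (C k n - m k n) * (s ^ k * ((c / real n) ^ k)\<^sup>2)"
    proof -
      have "real (card (?A - ?B)) = C k n - m k n"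
        unfolding card_Diff_subset[OF finite_subset[OF sub fin] sub]
          of_nat_diff[OF card_mono[OF fin sub]] card_k m_def ..
      then show ?thesis by (simp only: sum_constant)
    qed
    finally show ?thesis by (simp add: m_def algebra_simps)
  qed
  have T_lim: "T k \<longlonglongrightarrow> 0" for k
  proof -
    define N where "N n = real n ^ (2 * k)" for n
    have "(\<lambda>n. (1 / \<zeta>) ^ k * (?z n (n - 2 * k) / ?z n n)) \<longlonglongrightarrow> (1 / \<zeta>) ^ k * r ^ (2 * k)"
      by (intro tendsto_mult tendsto_const complete_partition_quotient_tendsto[OF assms(3-7)])
    \<comment> \<open>Here \<open>c\<close> arises: a planted edge costs a factor
      \<open>1 / \<zeta>\<close> and removes two vertices, each worth a factor \<open>r\<close>; the
      equation for \<open>r\<close> makes the product \<open>1 - r\<close>.\<close>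
    also have "(1 / \<zeta>) ^ k * r ^ (2 * k) = c ^ k"
      using assms(6) by (simp add: c_def power_mult flip: power_mult_distrib)
    finally have a: "(\<lambda>n. (1 / \<zeta>) ^ k * (?z n (n - 2 * k) / ?z n n)) \<longlonglongrightarrow> c ^ k" .
    have "(\<lambda>n. s ^ k * (m k n / N n * ((1 / \<zeta>) ^ k * (?z n (n - 2 * k) / ?z n n) - c ^ k)\<^sup>2
        + (C k n / N n - m k n / N n) * (c ^ k)\<^sup>2)) \<longlonglongrightarrow>
        s ^ k * ((1 / 2) ^ k / fact k * (c ^ k - c ^ k)\<^sup>2
        + ((1 / 2) ^ k / fact k - (1 / 2) ^ k / fact k) * (c ^ k)\<^sup>2)"
      unfolding m_def C_def N_def
      by (intro tendsto_mult tendsto_add tendsto_diff tendsto_power tendsto_const a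
          binomial_scaled_tendsto card_matchings_scaled_tendsto)
    moreover have "\<forall>\<^sub>F n in sequentially.
        s ^ k * (m k n / N n * ((1 / \<zeta>) ^ k * (?z n (n - 2 * k) / ?z n n) - c ^ k)\<^sup>2
        + (C k n / N n - m k n / N n) * (c ^ k)\<^sup>2) = T k n"
      using eventually_gt_at_top[of 0]
    proof eventually_elim
      case (elim n)
      define q where "q = (1 / \<zeta>) ^ k * (?z n (n - 2 * k) / ?z n n)"
      have n: "real n ^ k > 0" using elim by simp
      have N: "N n = (real n ^ k)\<^sup>2" by (simp add: N_def power_even_eq)
      have "\<alpha> k n = q / real n ^ k"
        by (simp add: \<alpha>_def q_def lam power_divide power_mult_distrib)
      then have "\<alpha> k n - (c / real n) ^ k = (q - c ^ k) / real n ^ k"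
        by (simp add: power_divide diff_divide_distrib)
      then show ?case
        unfolding T_eq q_def[symmetric]
        using n by (simp add: N power_divide field_simps)
    qed
    ultimately have "T k \<longlonglongrightarrow> s ^ k * ((1 / 2) ^ k / fact k * (c ^ k - c ^ k)\<^sup>2
        + ((1 / 2) ^ k / fact k - (1 / 2) ^ k / fact k) * (c ^ k)\<^sup>2)"
      by (rule Lim_transform_eventually)
    then show ?thesis by simp
  qed
  \<comment> \<open>Both coefficients lie between 0 and \<open>(1 / n) ^ k\<close>, and there are at
    most \<open>n ^ (2 * k) / fact k\<close> sets of \<open>k\<close> edges, so the powers of
    \<open>n\<close> cancel.\<close>
  have T_bound: "norm (T k n) \<le> s ^ k / fact k" if n: "n > 0" for k n
  proof -
    have g_bound: "g n S \<le> s ^ k * ((1 / real n) ^ k)\<^sup>2" if S: "card S = k" for S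
    proof -
      have "0 \<le> containment_prob (lam n) (?E n) S \<and> containment_prob (lam n) (?E n) S \<le> (1 / real n) ^ k"
      proof (cases "S \<in> matchings (?E n)")
        case True
        have l: "0 \<le> lam n" "lam n \<le> 1 / real n"
          using n assms(3) by (auto simp: lam field_simps)
        have "?z n (n - 2 * k) \<le> ?z n n"
          using complete_partition_mono[OF l(1)] by (auto simp: mono_def)
        then have "?z n (n - 2 * k) / ?z n n \<le> 1" using pos by simp
        moreover have "0 \<le> ?z n (n - 2 * k) / ?z n n" using pos by (simp add: less_imp_le)
        ultimately have "lam n ^ k * (?z n (n - 2 * k) / ?z n n) \<le> (1 / real n) ^ k * 1"
          using l by (intro mult_mono power_mono) auto
        then show ?thesis
          using True S l(1) pos by (simp add: containment_prob_matching less_imp_le)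
      qed (simp add: containment_prob_nonmatching)
      moreover have "0 \<le> (c / real n) ^ k" "(c / real n) ^ k \<le> (1 / real n) ^ k"
        using c n by (auto intro!: power_mono divide_right_mono)
      ultimately have "\<bar>containment_prob (lam n) (?E n) S - (c / real n) ^ k\<bar> \<le> \<bar>(1 / real n) ^ k\<bar>"
        by linarith
      then show ?thesis
        unfolding g_def S using s by (intro mult_left_mono) (simp_all only: abs_le_square_iff zero_le_power)
    qed
    have "T k n \<le> (\<Sum>S | S \<in> Pow (?E n) \<and> card S = k. s ^ k * ((1 / real n) ^ k)\<^sup>2)"
      unfolding T_def by (intro sum_mono g_bound) auto
    also have "\<dots> = C k n * (s ^ k * ((1 / real n) ^ k)\<^sup>2)"
      by (simp add: card_k[of n k, simplified])
    also have "C k n \<le> real n ^ (2 * k) / fact k"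
    proof -
      have "((n choose 2) choose k) * fact k \<le> (n choose 2) ^ k"
        by (rule binomial_fact_pow)
      also have "\<dots> \<le> (n ^ 2) ^ k"
        using binomial_fact_pow[of n 2] by (intro power_mono) (auto simp: fact_2)
      finally have "real (((n choose 2) choose k) * fact k) \<le> real ((n ^ 2) ^ k)"
        by (rule of_nat_mono)
      then show ?thesis
        by (simp add: C_def pos_le_divide_eq flip: power_mult)
    qed
    also have "real n ^ (2 * k) / fact k * (s ^ k * ((1 / real n) ^ k)\<^sup>2) = s ^ k / fact k"
      using n by (simp add: power_divide power_mult power2_eq_square power_mult_distrib)
    finally have "T k n \<le> s ^ k / fact k"
      using s by (simp add: mult_right_mono)
    moreover have "T k n \<ge> 0"
      unfolding T_def g_def using s by (intro sum_nonneg) auto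
    ultimately show ?thesis by simp
  qed
  \<comment> \<open>Layers beyond the number of edges are empty, so the finite sum may be written as
    a series with a range that is the same for all \<open>n\<close>.\<close>
  have sum_T: "sum (g n) (Pow (?E n)) = (\<Sum>k. T k n)" for n
  proof -
    have "(\<Sum>k. T k n) = (\<Sum>k\<le>card (?E n). T k n)"
    proof (rule suminf_finite)
      fix k assume "k \<notin> {..card (?E n)}"
      then have "{S \<in> Pow (?E n). card S = k} = {}"
        using card_mono[OF finite_complete_edges, of _ n] by auto
      then show "T k n = 0" unfolding T_def by (simp only: sum.empty)
    qed simp
    also have "\<dots> = sum (g n) (Pow (?E n))"
      unfolding T_def
      by (rule sum.group) (auto simp: finite_complete_edges intro: card_mono)
    finally show ?thesis ..
  qed
  have "((\<lambda>n. \<Sum>k. T k n) \<longlongrightarrow> (\<Sum>k. (0::real))) sequentially"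
  proof (rule conjunct2[OF conjunct2[OF tannerys_theorem]])
    show "\<And>k. (T k \<longlongrightarrow> 0) sequentially" by (rule T_lim)
    show "\<forall>\<^sub>F (k, n) in at_top \<times>\<^sub>F sequentially. norm (T k n) \<le> s ^ k / fact k"
      using eventually_prodI[OF eventually_True eventually_gt_at_top[of 0]]
      by (rule eventually_mono) (auto intro: T_bound[simplified])
    show "summable (\<lambda>k. s ^ k / fact k)"
      using summable_exp[of s] by (simp add: field_simps)
  qed simp
  then show ?thesis
    unfolding expectation_ratio_diff_square[OF p] c_def[symmetric] s_def[symmetric]
      g_def[symmetric] sum_T by simp
qed

section \<open>Gaussian laws and total variation\<close>

text \<open>The sign of \<open>\<alpha>\<close> is left free: the positive root standardises a
  Gaussian, and \<open>\<alpha> = - 1\<close> gives the symmetry of the standard Gaussian.\<close>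

lemma gaussian_eq_distr:
  assumes "b > 0" "\<bar>\<alpha>\<bar> = sqrt b"
  shows "gaussian a b = distr std_normal_distribution borel (\<lambda>x. a + \<alpha> * x)"
proof -
  interpret prob_space std_normal_distribution
    using real_dist_normal_dist by (simp add: real_distribution_def)
  have "distributed std_normal_distribution lborel (\<lambda>x. x) std_normal_density"
    by (simp add: distributed_def distr_id2)
  moreover have "\<alpha> \<noteq> 0" using assms by auto
  ultimately have "distributed std_normal_distribution lborel (\<lambda>x. a + \<alpha> * x) (normal_density a (sqrt b))"
    using normal_density_affine[of "\<lambda>x. x" 0 1 \<alpha> a] assms(2) by simp
  then have "distr std_normal_distribution lborel (\<lambda>x. a + \<alpha> * x) = gaussian a b"
    by (simp add: distributed_def gaussian_def)
  then show ?thesis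
    by (metis distr_cong sets_lborel)
qed

lemma real_distribution_gaussian: "b > 0 \<Longrightarrow> real_distribution (gaussian a b)"
  unfolding real_distribution_def real_distribution_axioms_def
  by (auto simp: gaussian_def intro: prob_space_normal_density)

lemma char_gaussian:
  assumes "b > 0"
  shows "char (gaussian a b) t = exp (\<i> * of_real (t * a) - of_real (t\<^sup>2 * b / 2))"
proof -
  have "char (gaussian a b) t = (CLINT x|std_normal_distribution. iexp (t * (a + sqrt b * x)))"
    unfolding char_def using assms
    by (subst gaussian_eq_distr[of b "sqrt b"]) (simp_all add: integral_distr)
  also have "\<dots> = (CLINT x|std_normal_distribution. iexp (t * a) * iexp (t * sqrt b * x))"
    by (simp add: algebra_simps exp_add[symmetric])
  also have "\<dots> = iexp (t * a) * char std_normal_distribution (t * sqrt b)"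
    by (simp add: char_def)
  also have "char std_normal_distribution (t * sqrt b) = exp (of_real (- (t\<^sup>2 * b / 2)))"
    using assms by (simp add: char_std_normal_distribution power_mult_distrib exp_of_real del: of_real_minus)
  finally show ?thesis
    by (simp flip: exp_add)
qed

lemma measure_gaussian_atMost_0:
  assumes "b > 0"
  shows "measure (gaussian a b) {..0} = std_normal_cdf (- a / sqrt b)"
proof -
  have "measure (gaussian a b) {..0} =
      measure std_normal_distribution ((\<lambda>x. a + sqrt b * x) -` {..0} \<inter> space std_normal_distribution)"
    using assms by (subst gaussian_eq_distr[of b "sqrt b"]) (simp_all add: measure_distr)
  also have "(\<lambda>x. a + sqrt b * x) -` {..0} \<inter> space std_normal_distribution = {..- a / sqrt b}"
    using assms by (auto simp: field_simps)
  finally show ?thesis by (simp add: std_normal_cdf_def cdf_def)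
qed

text \<open>By symmetry the left side is the mass of the closed half-line \<open>{x..}\<close>; its
  end point has mass 0.\<close>

lemma std_normal_cdf_uminus: "std_normal_cdf (- x) = 1 - std_normal_cdf x"
proof -
  let ?N = std_normal_distribution
  interpret prob_space ?N
    using real_dist_normal_dist by (simp add: real_distribution_def)
  have sym: "?N = distr ?N borel (\<lambda>x. - x)"
    using gaussian_eq_distr[of 1 "-1" 0] by (simp add: gaussian_def)
  have "emeasure ?N {x} = 0"
    by (subst emeasure_density) (auto simp: nn_integral_0_iff_AE intro: AE_mp[OF AE_lborel_singleton[of x]])
  then have null: "measure ?N {x} = 0" by (simp add: measure_def)
  have "std_normal_cdf (- x) = measure (distr ?N borel (\<lambda>x. - x)) {..- x}"
    unfolding std_normal_cdf_def cdf_def by (subst sym) simp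
  also have "\<dots> = measure ?N {x..}"
    by (subst measure_distr) (auto intro!: arg_cong[where f = "measure ?N"])
  also have "\<dots> = measure ?N {x<..} + measure ?N {x}"
    by (subst finite_measure_Union[symmetric]) (auto intro!: arg_cong[where f = "measure ?N"])
  also have "measure ?N {x<..} = 1 - measure ?N {..x}"
    using prob_compl[of "{..x}"] by (simp add: Compl_eq_Diff_UNIV[symmetric])
  finally show ?thesis by (simp add: null std_normal_cdf_def cdf_def)
qed

text \<open>Multiplying by \<open>exp\<close> shifts the mean of the Gaussian from \<open>- v / 2\<close> to \<open>v / 2\<close>.\<close>

lemma gaussian_integral_max_0_one_minus_exp:
  assumes v: "v > 0"
  shows "(\<integral>x. max 0 (1 - exp x) \<partial>gaussian (- (v / 2)) v) = 1 - 2 * std_normal_cdf (- (sqrt v / 2))"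
proof -
  let ?d = "\<lambda>a. normal_density a (sqrt v)"
  have shift: "?d (- (v / 2)) x * exp x = ?d (v / 2) x" for x
  proof -
    have "- (x - - (v / 2))\<^sup>2 / (2 * v) + x = - (x - v / 2)\<^sup>2 / (2 * v)"
      using v by (simp add: field_simps power2_eq_square)
    then show ?thesis
      using v by (simp add: normal_density_def flip: exp_add)
  qed
  have int: "integrable lborel (\<lambda>x. ?d a x * indicator {..0} x)" for a
    using v by (intro integrable_real_mult_indicator integrable_normal_density) auto
  have cdf: "(\<integral>x. ?d a x * indicator {..0} x \<partial>lborel) = std_normal_cdf (- a / sqrt v)" for a
  proof -
    have "(\<integral>x. ?d a x * indicator {..0} x \<partial>lborel) = (\<integral>x. indicator {..0} x \<partial>gaussian a v)"
      unfolding gaussian_def by (subst integral_density) (auto simp: mult.commute)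
    also have "\<dots> = measure (gaussian a v) {..0}"
      by (simp add: gaussian_def)
    finally show ?thesis using measure_gaussian_atMost_0[OF v] by simp
  qed
  have "(\<integral>x. max 0 (1 - exp x) \<partial>gaussian (- (v / 2)) v) =
      (\<integral>x. ?d (- (v / 2)) x * max 0 (1 - exp x) \<partial>lborel)"
    unfolding gaussian_def by (subst integral_density) auto
  \<comment> \<open>The positive part restricts the integral to \<open>{..0}\<close>, where
    \<open>shift\<close> turns the exponential term into the density with the opposite mean.\<close>
  also have "\<dots> = (\<integral>x. ?d (- (v / 2)) x * indicator {..0} x - ?d (v / 2) x * indicator {..0} x \<partial>lborel)"
    by (intro Bochner_Integration.integral_cong refl)
      (auto simp: shift[symmetric] algebra_simps max_def indicator_def)
  also have "\<dots> = std_normal_cdf (v / 2 / sqrt v) - std_normal_cdf (- (v / 2) / sqrt v)"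
    by (subst Bochner_Integration.integral_diff[OF int int]) (simp add: cdf)
  also have "v / 2 / sqrt v = sqrt v / 2"
    using v by (simp add: field_simps)
  also have "- (v / 2) / sqrt v = - (sqrt v / 2)"
    using v by (simp add: field_simps)
  finally show ?thesis
    using std_normal_cdf_uminus[of "sqrt v / 2"] by simp
qed

section \<open>Optimal tests, total variation and change of measure\<close>

lemma INF_testing_error:
  "(INF \<psi>. testing_error P Q \<psi>) = 1 - total_variation P Q"
proof -
  define g where "g S = measure_pmf.prob P S - measure_pmf.prob Q S" for S
  have err: "testing_error P Q \<psi> = 1 - g {A. \<psi> A}" for \<psi>
  proof -
    have "{A. \<psi> A = False} = UNIV - {A. \<psi> A}" by auto
    then show ?thesis
      using measure_pmf.prob_compl[of "{A. \<psi> A}" P] by (simp add: testing_error_def g_def)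
  qed
  have "g S \<le> 1" for S
  proof -
    have "measure_pmf.prob P S \<le> 1" by (rule measure_pmf.prob_le_1)
    moreover have "0 \<le> measure_pmf.prob Q S" by simp
    ultimately show ?thesis unfolding g_def by linarith
  qed
  then have bdd: "bdd_above (range g)" by (auto simp: bdd_above_def)
  have bdd': "bdd_below (range (testing_error P Q))"
    by (auto simp: bdd_below_def testing_error_def intro!: exI[of _ 0])
  show ?thesis
  proof (rule antisym)
    have "g S \<le> 1 - (INF \<psi>. testing_error P Q \<psi>)" for S
      using cINF_lower[OF bdd', of "\<lambda>A. A \<in> S"] err[of "\<lambda>A. A \<in> S"] by simp
    then have "(SUP S. g S) \<le> 1 - (INF \<psi>. testing_error P Q \<psi>)"
      by (intro cSUP_least) auto
    then show "(INF \<psi>. testing_error P Q \<psi>) \<le> 1 - total_variation P Q"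
      by (simp add: total_variation_def g_def)
    have "1 - (SUP S. g S) \<le> testing_error P Q \<psi>" for \<psi>
      using cSUP_upper[OF _ bdd, of "{A. \<psi> A}"] err[of \<psi>] by simp
    then show "1 - total_variation P Q \<le> (INF \<psi>. testing_error P Q \<psi>)"
      unfolding total_variation_def g_def[symmetric] by (intro cINF_greatest) auto
  qed
qed

lemma expectation_change_of_pmf:
  fixes h :: "'a \<Rightarrow> 'b::{banach, second_countable_topology}"
  assumes fin: "finite (set_pmf Q)" and dens: "\<And>A. pmf P A = pmf Q A * f A"
  shows "measure_pmf.expectation P h = measure_pmf.expectation Q (\<lambda>A. f A *\<^sub>R h A)"
proof -
  have "measure_pmf.expectation P h = (\<Sum>A\<in>set_pmf Q. pmf P A *\<^sub>R h A)"
    by (rule integral_measure_pmf[OF fin]) (simp add: set_pmf_iff dens)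
  then show ?thesis
    by (simp add: expectation_pmf_finite[OF fin] dens)
qed

text \<open>On passing to the complement of \<open>S\<close>, the difference of probabilities
  becomes the null integral of \<open>1 - f\<close> over that complement. It is largest when the
  complement is the set where \<open>f < 1\<close>, that is, for the likelihood ratio test.\<close>

lemma total_variation_eq_expectation:
  assumes fin: "finite (set_pmf Q)" and dens: "\<And>A. pmf P A = pmf Q A * f A"
  shows "total_variation P Q = measure_pmf.expectation Q (\<lambda>A. max 0 (1 - f A))"
proof -
  have int: "integrable (measure_pmf Q) g" for g :: "_ \<Rightarrow> real"
    by (rule integrable_measure_pmf_finite[OF fin])
  have diff: "measure_pmf.prob P S - measure_pmf.prob Q S =
      measure_pmf.expectation Q (\<lambda>A. (1 - f A) * indicator (- S) A)" for S
  proof -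
    have "measure_pmf.prob P (- S) = measure_pmf.expectation P (indicator (- S))"
      by simp
    also have "\<dots> = measure_pmf.expectation Q (\<lambda>A. f A * indicator (- S) A)"
      using expectation_change_of_pmf[OF fin dens, of "indicator (- S) :: _ \<Rightarrow> real"] by simp
    finally have P: "measure_pmf.prob P (- S) = measure_pmf.expectation Q (\<lambda>A. f A * indicator (- S) A)" .
    have Q: "measure_pmf.prob Q (- S) = measure_pmf.expectation Q (indicator (- S))"
      by simp
    have "measure_pmf.prob P S - measure_pmf.prob Q S =
        measure_pmf.prob Q (- S) - measure_pmf.prob P (- S)"
      using measure_pmf.prob_compl[of S P] measure_pmf.prob_compl[of S Q]
      by (simp add: Compl_eq_Diff_UNIV)
    also have "\<dots> = measure_pmf.expectation Q (\<lambda>A. indicator (- S) A - f A * indicator (- S) A)"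
      unfolding P Q by (rule Bochner_Integration.integral_diff[OF int int, symmetric])
    finally show ?thesis by (simp add: left_diff_distrib)
  qed
  show ?thesis
    unfolding total_variation_def
  proof (rule cSup_eq_maximum)
    have "measure_pmf.expectation Q (\<lambda>A. max 0 (1 - f A)) =
        measure_pmf.prob P {A. f A \<ge> 1} - measure_pmf.prob Q {A. f A \<ge> 1}"
      unfolding diff by (intro Bochner_Integration.integral_cong refl) (auto simp: indicator_def)
    then show "measure_pmf.expectation Q (\<lambda>A. max 0 (1 - f A)) \<in>
        range (\<lambda>S. measure_pmf.prob P S - measure_pmf.prob Q S)"
      by (rule range_eqI)
    fix x assume "x \<in> range (\<lambda>S. measure_pmf.prob P S - measure_pmf.prob Q S)"
    then obtain S where "x = measure_pmf.expectation Q (\<lambda>A. (1 - f A) * indicator (- S) A)"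
      unfolding diff by auto
    also have "\<dots> \<le> measure_pmf.expectation Q (\<lambda>A. max 0 (1 - f A))"
      by (intro integral_mono int) (auto simp: indicator_def)
    finally show "x \<le> measure_pmf.expectation Q (\<lambda>A. max 0 (1 - f A))" .
  qed
qed

section \<open>Laws of statistics and moments of the tilted ratio\<close>

lemma law_of_cong: "(\<And>A. A \<in> set_pmf R \<Longrightarrow> X A = Y A) \<Longrightarrow> law_of R X = law_of R Y"
  unfolding law_of_def by (rule distr_cong_AE) (auto simp: AE_measure_pmf_iff)

lemma real_distribution_law_of: "real_distribution (law_of R X)"
  unfolding law_of_def by (rule prob_space.real_distribution_distr[OF prob_space_measure_pmf]) simp

lemma char_law_of: "char (law_of R X) t = measure_pmf.expectation R (\<lambda>A. iexp (t * X A))"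
  unfolding law_of_def char_def by (subst integral_distr) auto

lemma tilted_ratio_pos:
  assumes "0 < p" "p < 1" "0 \<le> a" "a < 1"
  shows "tilted_ratio p a E A > 0"
  unfolding tilted_ratio_def
proof (rule prod_pos)
  fix e
  define k where "k = (1 - p) / p"
  have "0 \<le> k" using assms by (simp add: k_def)
  then show "0 < 1 + a * centred_obs p (A e)"
    using assms(3,4) by (simp add: centred_obs_def k_def[symmetric] add_pos_nonneg)
qed

text \<open>The logarithm is a sum over edges, so independence factorises the expectation into
  \<open>n choose 2\<close> equal factors.\<close>

lemma expectation_tilted_ratio_tendsto:
  fixes z :: complex
  assumes p: "0 < p" "p < 1" and c: "0 \<le> c" "c < 1"
  shows "(\<lambda>n. measure_pmf.expectation (null_model n p)
      (\<lambda>A. exp (z * of_real (ln (tilted_ratio p (c / real n) (complete_edges n) A)))))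
    \<longlonglongrightarrow> exp (of_real (c\<^sup>2 / 4 * ((1 - p) / p)) * (z * (z - 1)))"
proof -
  have "measure_pmf.expectation (null_model n p)
      (\<lambda>A. exp (z * of_real (ln (tilted_ratio p (c / real n) (complete_edges n) A)))) =
      (of_real p * exp (z * of_real (ln (1 + c * ((1 - p) / p) / real n)))
      + of_real (1 - p) * exp (z * of_real (ln (1 + - c / real n)))) ^ (n choose 2)" for n
  proof -
    \<comment> \<open>For \<open>n = 0\<close> the quotient is 0, so the bound holds for every
      \<open>n\<close>.\<close>
    have "c / real n \<le> c"
      using c by (cases "n = 0") (auto simp: divide_le_eq mult_le_cancel_left1)
    then have a: "0 \<le> c / real n" "c / real n < 1" using c by auto
    \<comment> \<open>Positivity of a single factor is the instance of
      \<open>tilted_ratio_pos\<close> with just one edge.\<close>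
    have pos: "0 < 1 + c / real n * centred_obs p b" for b
      using tilted_ratio_pos[OF p a, of "{undefined}" "\<lambda>_. b"] by (simp add: tilted_ratio_def)
    have "exp (z * of_real (ln (tilted_ratio p (c / real n) (complete_edges n) A))) =
        (\<Prod>e\<in>complete_edges n. exp (z * of_real (ln (1 + c / real n * centred_obs p (A e)))))" for A
    proof -
      have "ln (tilted_ratio p (c / real n) (complete_edges n) A) =
          (\<Sum>e\<in>complete_edges n. ln (1 + c / real n * centred_obs p (A e)))"
        unfolding tilted_ratio_def
        by (rule ln_prod[OF finite_complete_edges]) (metis pos less_irrefl)
      then show ?thesis
        by (simp only: of_real_sum sum_distrib_left exp_sum[OF finite_complete_edges])
    qed
    then show ?thesis
      using expectation_prod_bernoulli[OF finite_complete_edges[of n], where p = p and d = False and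
          f = "\<lambda>e b. exp (z * of_real (ln (1 + c / real n * centred_obs p b)))"] p
      by (simp add: null_model_def centred_obs_def complete_edges_eq_pairs card_pairs
          mult.commute[of "real n" p])
  qed
  then show ?thesis
    using tilted_bernoulli_power_tendsto[OF p, of z c] by simp
qed

section \<open>The limit theorem\<close>

text \<open>Here \<open>r\<close> is the limiting ratio of consecutive partition functions, given by
  its quadratic equation rather than in closed form.\<close>

locale planted_matching_limit =
  fixes p \<zeta> r :: real and lam :: "nat \<Rightarrow> real"
  assumes p: "0 < p" "p < 1" and \<zeta>: "\<zeta> \<ge> 40" and r: "0 < r" "r < 1" "r\<^sup>2 / \<zeta> = 1 - r"
    and lam: "\<And>n. lam n = 1 / (\<zeta> * real n)"
begin

definition "c = 1 - r"

text \<open>The absolute value of both limiting means, and half of the common variance.\<close>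

definition "\<kappa> = c\<^sup>2 / 4 * ((1 - p) / p)"

definition "P n = planted_model n p (lam n)"

definition "Q n = null_model n p"

definition "L n = planted_ratio p (lam n) (complete_edges n)"

definition "G n = tilted_ratio p (c / real n) (complete_edges n)"

abbreviation "EXQ n \<equiv> measure_pmf.expectation (Q n)"

section \<open>Positivity, finiteness and densities along the sequence of models\<close>

lemma c: "0 < c" "c < 1"
  using r by (auto simp: c_def)

lemma \<kappa>_pos: "\<kappa> > 0"
  using c p by (simp add: \<kappa>_def)

lemma lam_nonneg: "lam n \<ge> 0"
  using \<zeta> by (simp add: lam)

lemma L_pos: "L n A > 0"
  unfolding L_def using p lam_nonneg by (intro planted_ratio_pos finite_complete_edges)

lemma G_pos: "G n A > 0"
proof -
  have "c / real n < 1"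
    using c by (cases "n = 0") (auto simp: divide_less_eq)
  then show ?thesis
    unfolding G_def using p c by (intro tilted_ratio_pos) auto
qed

lemma finite_Q: "finite (set_pmf (Q n))"
  unfolding Q_def null_model_def by (intro finite_set_Pi_pmf_bool finite_complete_edges)

lemma integrable_Q: "integrable (measure_pmf (Q n)) (f :: _ \<Rightarrow> 'b :: {banach, second_countable_topology})"
  by (rule integrable_measure_pmf_finite[OF finite_Q])

lemma pmf_P: "pmf (P n) A = pmf (Q n) A * L n A"
  unfolding P_def Q_def L_def using p lam_nonneg by (intro pmf_planted_model)

lemma log_likelihood_ratio_Q: "A \<in> set_pmf (Q n) \<Longrightarrow> log_likelihood_ratio (P n) (Q n) A = ln (L n A)"
  by (intro log_likelihood_ratio_pmf pmf_P less_imp_le L_pos)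

lemma log_likelihood_ratio_P: "A \<in> set_pmf (P n) \<Longrightarrow> log_likelihood_ratio (P n) (Q n) A = ln (L n A)"
  by (rule log_likelihood_ratio_Q) (auto simp: set_pmf_iff pmf_P)

section \<open>Approximation in mean and characteristic functions\<close>

lemma L2_distance: "(\<lambda>n. EXQ n (\<lambda>A. (L n A - G n A)\<^sup>2)) \<longlonglongrightarrow> 0"
  unfolding Q_def L_def G_def c_def
  using p \<zeta> r lam by (intro ratio_diff_square_tendsto_0) auto

lemma G_expectation:
  fixes z :: complex
  shows "(\<lambda>n. EXQ n (\<lambda>A. exp (z * of_real (ln (G n A))))) \<longlonglongrightarrow> exp (of_real \<kappa> * (z * (z - 1)))"
  unfolding Q_def G_def \<kappa>_def using p c by (intro expectation_tilted_ratio_tendsto) auto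

lemma L1_distance: "(\<lambda>n. EXQ n (\<lambda>A. \<bar>L n A - G n A\<bar>)) \<longlonglongrightarrow> 0"
proof (rule tendsto_sandwich[where f = "\<lambda>_. 0"])
  show "\<forall>\<^sub>F n in sequentially. EXQ n (\<lambda>A. \<bar>L n A - G n A\<bar>) \<le> sqrt (EXQ n (\<lambda>A. (L n A - G n A)\<^sup>2))"
    using expectation_mult_le_sqrt[OF finite_Q, where Y = "\<lambda>_. 1"]
    by (intro always_eventually allI) simp
  show "(\<lambda>n. sqrt (EXQ n (\<lambda>A. (L n A - G n A)\<^sup>2))) \<longlonglongrightarrow> 0"
    using tendsto_real_sqrt[OF L2_distance] by simp
qed (auto intro!: always_eventually)

text \<open>Cauchy-Schwarz against \<open>1 / G\<close>, whose second moment converges and is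
  therefore bounded.\<close>

lemma relative_L1_distance: "(\<lambda>n. EXQ n (\<lambda>A. \<bar>L n A - G n A\<bar> * (1 / G n A))) \<longlonglongrightarrow> 0"
proof (rule tendsto_sandwich[where f = "\<lambda>_. 0"])
  show "\<forall>\<^sub>F n in sequentially. EXQ n (\<lambda>A. \<bar>L n A - G n A\<bar> * (1 / G n A)) \<le>
      sqrt (EXQ n (\<lambda>A. (L n A - G n A)\<^sup>2)) * sqrt (EXQ n (\<lambda>A. (1 / G n A)\<^sup>2))"
  proof (intro always_eventually allI)
    fix n
    show "EXQ n (\<lambda>A. \<bar>L n A - G n A\<bar> * (1 / G n A)) \<le>
        sqrt (EXQ n (\<lambda>A. (L n A - G n A)\<^sup>2)) * sqrt (EXQ n (\<lambda>A. (1 / G n A)\<^sup>2))"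
      using expectation_mult_le_sqrt[OF finite_Q, of n "\<lambda>A. L n A - G n A" "\<lambda>A. 1 / G n A"] G_pos[of n]
      by (simp add: abs_of_pos)
  qed
  \<comment> \<open>The inverse square is the complex power with exponent - 2, so its expectation
    tends to \<open>exp (6 * \<kappa>)\<close>.\<close>
  have "EXQ n (\<lambda>A. (1 / G n A)\<^sup>2) = Re (EXQ n (\<lambda>A. exp (- 2 * of_real (ln (G n A)))))" for n
  proof -
    have "(1 / G n A)\<^sup>2 = Re (exp (- 2 * of_real (ln (G n A))))" for A
    proof -
      have "exp (- 2 * complex_of_real (ln (G n A))) = of_real (exp (- 2 * ln (G n A)))"
        by (simp flip: exp_of_real)
      also have "exp (- 2 * ln (G n A)) = (1 / G n A)\<^sup>2"
        using G_pos[of n A] by (simp add: exp_minus exp_double field_simps)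
      finally show ?thesis by simp
    qed
    then show ?thesis by (simp only: integral_Re[OF integrable_Q])
  qed
  then have "(\<lambda>n. EXQ n (\<lambda>A. (1 / G n A)\<^sup>2)) \<longlonglongrightarrow> Re (exp (of_real \<kappa> * (- 2 * (- 2 - 1))))"
    using tendsto_Re[OF G_expectation[of "- 2"]] by (simp only:)
  from tendsto_mult[OF tendsto_real_sqrt[OF L2_distance] tendsto_real_sqrt[OF this]]
  show "(\<lambda>n. sqrt (EXQ n (\<lambda>A. (L n A - G n A)\<^sup>2)) * sqrt (EXQ n (\<lambda>A. (1 / G n A)\<^sup>2))) \<longlonglongrightarrow> 0"
    by simp
qed (auto intro!: always_eventually integral_nonneg simp: G_pos less_imp_le)

lemma expectation_diff_tendsto:
  fixes f g :: "nat \<Rightarrow> (nat set \<Rightarrow> bool) \<Rightarrow> complex"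
  assumes bound: "\<And>n A. cmod (f n A - g n A) \<le> C * h n A"
    and h: "(\<lambda>n. EXQ n (h n)) \<longlonglongrightarrow> 0" and g: "(\<lambda>n. EXQ n (g n)) \<longlonglongrightarrow> l"
  shows "(\<lambda>n. EXQ n (f n)) \<longlonglongrightarrow> l"
proof -
  have "(\<lambda>n. EXQ n (f n) - EXQ n (g n)) \<longlonglongrightarrow> 0"
  proof (rule Lim_null_comparison)
    show "\<forall>\<^sub>F n in sequentially. cmod (EXQ n (f n) - EXQ n (g n)) \<le> C * EXQ n (h n)"
    proof (intro always_eventually allI)
      fix n
      have "EXQ n (f n) - EXQ n (g n) = EXQ n (\<lambda>A. f n A - g n A)"
        by (rule Bochner_Integration.integral_diff[OF integrable_Q integrable_Q, symmetric])
      also have "cmod \<dots> \<le> EXQ n (\<lambda>A. cmod (f n A - g n A))"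
        by (rule integral_norm_bound)
      also have "\<dots> \<le> EXQ n (\<lambda>A. C * h n A)"
        by (intro integral_mono integrable_Q bound)
      finally show "cmod (EXQ n (f n) - EXQ n (g n)) \<le> C * EXQ n (h n)" by simp
    qed
    show "(\<lambda>n. C * EXQ n (h n)) \<longlonglongrightarrow> 0"
      using tendsto_mult[OF tendsto_const h, of C] by simp
  qed
  from tendsto_add[OF this g] show ?thesis by simp
qed

text \<open>With F(x) = exp (i t ln x), the product G (F(L) - F(G)) equals (L F(L) - G F(G)) - (L -
  G) F(L). The first part is controlled by the Lipschitz bound and the second by unit modulus, so
  only a division by \<open>G\<close> remains and \<open>L\<close> may be arbitrarily small.\<close>

lemma iexp_ln_diff_le:
  "cmod (iexp (t * ln (L n A)) - iexp (t * ln (G n A))) \<le> (2 + \<bar>t\<bar>) * (\<bar>L n A - G n A\<bar> * (1 / G n A))"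
proof -
  let ?F = "\<lambda>x. iexp (t * ln x)"
  have "of_real (G n A) * (?F (L n A) - ?F (G n A)) =
      (of_real (L n A) * ?F (L n A) - of_real (G n A) * ?F (G n A)) - of_real (L n A - G n A) * ?F (L n A)"
    by (simp add: algebra_simps)
  also have "cmod \<dots> \<le> cmod (of_real (L n A) * ?F (L n A) - of_real (G n A) * ?F (G n A)) +
      cmod (of_real (L n A - G n A) * ?F (L n A))"
    by (rule norm_triangle_ineq4)
  also have "\<dots> \<le> (1 + \<bar>t\<bar>) * \<bar>L n A - G n A\<bar> + \<bar>L n A - G n A\<bar>"
    using mult_iexp_ln_lipschitz[OF L_pos[of n A] G_pos[of n A], of t]
    by (intro add_mono) (simp_all only: norm_mult norm_of_real norm_exp_i_times, simp_all)
  also have "\<dots> = (2 + \<bar>t\<bar>) * \<bar>L n A - G n A\<bar>"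
    by (simp add: algebra_simps)
  finally have "G n A * cmod (?F (L n A) - ?F (G n A)) \<le> (2 + \<bar>t\<bar>) * \<bar>L n A - G n A\<bar>"
    unfolding norm_mult norm_of_real abs_of_pos[OF G_pos] .
  then show ?thesis
    using G_pos[of n A] by (simp add: field_simps)
qed

text \<open>At the exponent z = i t the limit of the moments of \<open>G\<close> has the logarithm -
  i \<kappa> t - \<kappa> t^2.\<close>

lemma char_Q_tendsto:
  "(\<lambda>n. EXQ n (\<lambda>A. iexp (t * ln (L n A)))) \<longlonglongrightarrow> char (gaussian (- \<kappa>) (2 * \<kappa>)) t"
proof (rule expectation_diff_tendsto[OF iexp_ln_diff_le relative_L1_distance])
  have "of_real \<kappa> * ((\<i> * of_real t) * (\<i> * of_real t - 1)) =
      \<i> * of_real (t * - \<kappa>) - of_real (t\<^sup>2 * (2 * \<kappa>) / 2)"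
    by (simp add: algebra_simps power2_eq_square)
  then show "(\<lambda>n. EXQ n (\<lambda>A. iexp (t * ln (G n A)))) \<longlonglongrightarrow> char (gaussian (- \<kappa>) (2 * \<kappa>)) t"
    using G_expectation[of "\<i> * of_real t"] \<kappa>_pos by (simp only: char_gaussian) (simp add: mult.assoc)
qed

text \<open>The change of measure inserts a factor \<open>L\<close>, so the integrand is Lipschitz
  in \<open>L\<close> and the plain mean distance suffices. At the exponent z = 1 + i t the mean
  changes its sign and the variance is kept.\<close>

lemma char_P_tendsto:
  "(\<lambda>n. measure_pmf.expectation (P n) (\<lambda>A. iexp (t * ln (L n A)))) \<longlonglongrightarrow> char (gaussian \<kappa> (2 * \<kappa>)) t"
proof -
  have "(\<lambda>n. EXQ n (\<lambda>A. of_real (L n A) * iexp (t * ln (L n A)))) \<longlonglongrightarrow> char (gaussian \<kappa> (2 * \<kappa>)) t"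
  proof (rule expectation_diff_tendsto[OF mult_iexp_ln_lipschitz[OF L_pos G_pos] L1_distance])
    have eq: "of_real \<kappa> * ((1 + \<i> * of_real t) * (1 + \<i> * of_real t - 1)) =
        \<i> * of_real (t * \<kappa>) - of_real (t\<^sup>2 * (2 * \<kappa>) / 2)"
      by (simp add: algebra_simps power2_eq_square)
    have "exp ((1 + \<i> * of_real t) * of_real (ln (G n A))) = of_real (G n A) * iexp (t * ln (G n A))" for n A
      using G_pos[of n A] by (simp add: distrib_right exp_add exp_of_real mult.assoc)
    then show "(\<lambda>n. EXQ n (\<lambda>A. of_real (G n A) * iexp (t * ln (G n A)))) \<longlonglongrightarrow> char (gaussian \<kappa> (2 * \<kappa>)) t"
      using G_expectation[of "1 + \<i> * of_real t"] \<kappa>_pos by (simp only: eq char_gaussian)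
  qed
  then show ?thesis
    by (simp add: expectation_change_of_pmf[OF finite_Q pmf_P] scaleR_conv_of_real)
qed

section \<open>Weak convergence and the limit of the total variation distance\<close>

lemma weak_conv_Q:
  "weak_conv_m (\<lambda>n. law_of (Q n) (log_likelihood_ratio (P n) (Q n))) (gaussian (- \<kappa>) (2 * \<kappa>))"
proof (rule levy_continuity)
  have "law_of (Q n) (log_likelihood_ratio (P n) (Q n)) = law_of (Q n) (\<lambda>A. ln (L n A))" for n
    by (rule law_of_cong) (rule log_likelihood_ratio_Q)
  then show "(\<lambda>n. char (law_of (Q n) (log_likelihood_ratio (P n) (Q n))) t)
      \<longlonglongrightarrow> char (gaussian (- \<kappa>) (2 * \<kappa>)) t" for t
    using char_Q_tendsto by (simp only: char_law_of)
qed (use \<kappa>_pos in \<open>auto intro: real_distribution_law_of real_distribution_gaussian\<close>)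

lemma weak_conv_P:
  "weak_conv_m (\<lambda>n. law_of (P n) (log_likelihood_ratio (P n) (Q n))) (gaussian \<kappa> (2 * \<kappa>))"
proof (rule levy_continuity)
  have "law_of (P n) (log_likelihood_ratio (P n) (Q n)) = law_of (P n) (\<lambda>A. ln (L n A))" for n
    by (rule law_of_cong) (rule log_likelihood_ratio_P)
  then show "(\<lambda>n. char (law_of (P n) (log_likelihood_ratio (P n) (Q n))) t)
      \<longlonglongrightarrow> char (gaussian \<kappa> (2 * \<kappa>)) t" for t
    using char_P_tendsto by (simp only: char_law_of)
qed (use \<kappa>_pos in \<open>auto intro: real_distribution_law_of real_distribution_gaussian\<close>)

text \<open>The positive part of \<open>1 - exp x\<close> is continuous with values between 0 and 1,
  so weak convergence under the null model carries over to its integral.\<close>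

lemma total_variation_tendsto:
  "(\<lambda>n. 1 - total_variation (P n) (Q n)) \<longlonglongrightarrow> 2 * std_normal_cdf (- (sqrt (2 * \<kappa>) / 2))"
proof -
  let ?h = "\<lambda>x::real. max 0 (1 - exp x)"
  have "total_variation (P n) (Q n) = (\<integral>x. ?h x \<partial>law_of (Q n) (log_likelihood_ratio (P n) (Q n)))" for n
  proof -
    have "total_variation (P n) (Q n) = EXQ n (\<lambda>A. max 0 (1 - L n A))"
      by (rule total_variation_eq_expectation[OF finite_Q pmf_P])
    also have "\<dots> = EXQ n (\<lambda>A. ?h (log_likelihood_ratio (P n) (Q n) A))"
      by (intro integral_cong_AE) (auto simp: AE_measure_pmf_iff log_likelihood_ratio_Q L_pos)
    also have "\<dots> = (\<integral>x. ?h x \<partial>law_of (Q n) (log_likelihood_ratio (P n) (Q n)))"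
      unfolding law_of_def by (subst integral_distr) auto
    finally show ?thesis .
  qed
  moreover have "(\<lambda>n. \<integral>x. ?h x \<partial>law_of (Q n) (log_likelihood_ratio (P n) (Q n)))
      \<longlonglongrightarrow> (\<integral>x. ?h x \<partial>gaussian (- \<kappa>) (2 * \<kappa>))"
  proof (rule weak_conv_imp_integral_bdd_continuous_conv[OF _ _ weak_conv_Q, where B = 1])
    show "isCont ?h x" for x by (intro continuous_intros)
    show "norm (?h x) \<le> 1" for x by (simp add: max_def)
  qed (use \<kappa>_pos in \<open>auto intro: real_distribution_law_of real_distribution_gaussian\<close>)
  moreover have "(\<integral>x. ?h x \<partial>gaussian (- \<kappa>) (2 * \<kappa>)) = 1 - 2 * std_normal_cdf (- (sqrt (2 * \<kappa>) / 2))"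
    using gaussian_integral_max_0_one_minus_exp[of "2 * \<kappa>"] \<kappa>_pos by simp
  ultimately have "(\<lambda>n. total_variation (P n) (Q n)) \<longlonglongrightarrow> 1 - 2 * std_normal_cdf (- (sqrt (2 * \<kappa>) / 2))"
    by simp
  from tendsto_diff[OF tendsto_const this, of 1] show ?thesis by simp
qed

end

theorem theorem2p8:
  fixes p q \<zeta> c :: real
    and lam :: "nat \<Rightarrow> real"
    and P Q :: "nat \<Rightarrow> (nat set \<Rightarrow> bool) pmf"
  assumes "p = q" and "0 < p" and "p < 1"
    and "\<zeta> \<ge> 40"
    and "\<And>n. lam n = 1 / (\<zeta> * real n)"
    and "c = 1 - 1 / 2 * (sqrt (\<zeta>\<^sup>2 + 4 * \<zeta>) - \<zeta>)"
    and "\<And>n. P n = planted_model n p (lam n)"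
    and "\<And>n. Q n = null_model n q"
  shows "c \<in> {0<..<1} \<and>
    weak_conv_m (\<lambda>n. law_of (P n) (log_likelihood_ratio (P n) (Q n)))
           (gaussian (c\<^sup>2 / 4 * ((1 - p) / p)) (c\<^sup>2 / 2 * ((1 - p) / p))) \<and>
    weak_conv_m (\<lambda>n. law_of (Q n) (log_likelihood_ratio (P n) (Q n)))
           (gaussian (- (c\<^sup>2 / 4 * ((1 - p) / p))) (c\<^sup>2 / 2 * ((1 - p) / p))) \<and>
    (\<forall>n. (INF \<psi>. testing_error (P n) (Q n) \<psi>) = 1 - total_variation (P n) (Q n)) \<and>
    (\<lambda>n. 1 - total_variation (P n) (Q n))
           \<longlonglongrightarrow> 2 * std_normal_cdf (- (c / (2 * sqrt 2) * sqrt ((1 - p) / p)))"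
proof -
  define w where "w = sqrt (\<zeta>\<^sup>2 + 4 * \<zeta>)"
  \<comment> \<open>The positive root of r^2 + \<zeta> r = \<zeta>.\<close>
  define r where "r = (w - \<zeta>) / 2"
  have w2: "w\<^sup>2 = \<zeta>\<^sup>2 + 4 * \<zeta>" and "w \<ge> 0" using assms(4) by (simp_all add: w_def)
  have "\<zeta> < w" unfolding w_def using assms(4) by (intro real_less_rsqrt) simp
  \<comment> \<open>The square of \<open>\<zeta> + 2\<close> exceeds that of \<open>w\<close> by 4;
    this gives \<open>r < 1\<close>.\<close>
  moreover have "w < \<zeta> + 2" unfolding w_def using assms(4)
    by (intro real_less_lsqrt) (auto simp: power2_eq_square algebra_simps)
  ultimately have r: "0 < r" "r < 1" by (auto simp: r_def)
  have "r\<^sup>2 = \<zeta> * (1 - r)"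
    using w2 by (simp add: r_def power2_eq_square field_simps)
  then have r2: "r\<^sup>2 / \<zeta> = 1 - r" using assms(4) by simp
  have c: "c = 1 - r" using assms(6) by (simp add: r_def w_def)
  interpret lim: planted_matching_limit p \<zeta> r lam
    using assms r r2 by unfold_locales auto
  have P: "P n = lim.P n" and Q: "Q n = lim.Q n" for n
    unfolding lim.P_def lim.Q_def using assms by simp_all
  have c': "lim.c = c" by (simp add: lim.c_def c)
  have \<kappa>: "lim.\<kappa> = c\<^sup>2 / 4 * ((1 - p) / p)" by (simp add: lim.\<kappa>_def c')
  have \<kappa>2: "2 * lim.\<kappa> = c\<^sup>2 / 2 * ((1 - p) / p)" by (simp add: \<kappa>)
  have c01: "0 < c" "c < 1" using r by (simp_all add: c)
  have sqrt_\<kappa>: "sqrt (2 * lim.\<kappa>) / 2 = c / (2 * sqrt 2) * sqrt ((1 - p) / p)"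
    unfolding \<kappa>2 real_sqrt_mult real_sqrt_divide using c01 by (simp add: field_simps)
  have "c \<in> {0<..<1}" using c01 by simp
  then show ?thesis
    unfolding P Q
    by (intro conjI allI INF_testing_error lim.weak_conv_P[unfolded \<kappa>2, unfolded \<kappa>]
        lim.weak_conv_Q[unfolded \<kappa>2, unfolded \<kappa>] lim.total_variation_tendsto[unfolded sqrt_\<kappa>])
qed

end
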